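(* Let $(\mathbb A,\beta)$ be an $s$-stage Runge--Kutta method that is A-stable, with $\mathbb A\in\mathbb R^{s\times s}$ invertible and $|R(\infty)|<1$, and that is algebraically stable, i.e. $\operatorname{diag}(\beta)\mathbb A+\mathbb A^{\mathsf T}\operatorname{diag}(\beta)-\beta\beta^{\mathsf T}\succeq0$ (positive semidefinite), with weights $\beta_\ell>0$ for all $\ell$. Then the fixed-stress iteration with stabilization parameter $L>0$ (see context) satisfies, for every time step $n$ and every iteration index $i\ge2$, $$\|P^{n,i}-P^{n,i-1}\|_{c,\beta}\le\rho_{\mathrm{FS}}\,\|P^{n,i-1}-P^{n,i-2}\|_{c,\beta}$$ with contraction rate $$\rho_{\mathrm{FS}}=\max_{\mu\in[0,\omega]}\frac{|L-\mu|}{1+L}.$$ In particular, $\rho_{\mathrm{FS}}<1$ for all $L>\max\big(0,\tfrac{\omega-1}2\big)$, and the optimal choice $L=\omega/2$ yields $\rho_{\mathrm{FS}}=\omega/(2+\omega)$.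
   Context: Setting. $\Omega\subseteq\mathbb R^m$, $m\in\{2,3\}$, is a bounded Lipschitz domain, $\mathcal V=[H^1_0(\Omega)]^m$, $\mathcal Q=H^1_0(\Omega)$, $\mathcal H_{\mathcal V}=[L^2(\Omega)]^m$, $\mathcal H_{\mathcal Q}=L^2(\Omega)$, with the usual Gelfand triples. The bilinear forms $a:\mathcal V\times\mathcal V\to\mathbb R$, $b:\mathcal Q\times\mathcal Q\to\mathbb R$, $c:\mathcal H_{\mathcal Q}\times\mathcal H_{\mathcal Q}\to\mathbb R$ are symmetric, continuous and elliptic, with ellipticity constants $c_a,c_b,c_c>0$; $\|\cdot\|_c=c(\cdot,\cdot)^{1/2}$. The form $d:\mathcal V\times\mathcal H_{\mathcal Q}\to\mathbb R$ is bilinear and satisfies $d(u,p)\le C_d\|u\|_{\mathcal V}\|p\|_{\mathcal H_{\mathcal Q}}$ with $C_d>0$. The coupling strength is $\omega:=C_d^2/(c_ac_c)$. The operators $\mathcal A:\mathcal V\to\mathcal V^*$, $\mathcal B:\mathcal Q\to\mathcal Q^*$, $\mathcal C:\mathcal H_{\mathcal Q}\to\mathcal H_{\mathcal Q}^*$, $\mathcal D:\mathcal V\to\mathcal H_{\mathcal Q}^*$ are those associated with $a,b,c,d$; $\mathcal M:=\mathcal D\mathcal A^{-1}\mathcal D^*$. The paper takes $\mathcal C^{-1}\mathcal M$ to be self-adjoint, non-negative and compact on $\mathcal H_{\mathcal Q}$, with eigenvalues in $[0,\omega]$. Runge--Kutta method. $\beta\in\mathbb R^s$, $\mathbf 1=[1,\dots,1]^{\mathsf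 T}\in\mathbb R^s$, $\chi=\mathbb A\mathbf 1$, $R(z)=1+z\beta^{\mathsf T}(I_s-z\mathbb A)^{-1}\mathbf 1$, $R(\infty)=1-\beta^{\mathsf T}\mathbb A^{-1}\mathbf 1$; A-stable means $|R(z)|\le1$ for $\operatorname{Re}z\le0$. Fixed-stress iteration. Let $\tau>0$, $t^n=n\tau$, $F^n\in(\mathcal V^* )^s$, $G^n\in(\mathcal Q^* )^s$ with $F^n_\ell=f(t^{n-1}+\chi_\ell\tau)$, $G^n_\ell=g(t^{n-1}+\chi_\ell\tau)$ for given $f:[0,T]\to\mathcal V^*$, $g:[0,T]\to\mathcal Q^*$. At time step $n$, with $u^{n-1},p^{n-1}$ given, set $U^{n,0}=\mathbf 1u^{n-1}$, $P^{n,0}=\mathbf 1p^{n-1}$ (all stages equal to the solution from the previous time step), and for $i\ge1$ let $U^{n,i}\in\mathcal V^s$, $P^{n,i}\in\mathcal Q^s$ solve $$(I_s\otimes\mathcal A)U^{n,i}-(I_s\otimes\mathcal D^* )P^{n,i}=F^n\quad\text{in }(\mathcal V^* )^s,$$ $$(I_s\otimes\mathcal D)\dot U^{n,i-1}+(I_s\otimes\mathcal C)\dot P^{n,i}+(I_s\otimes\mathcal B)P^{n,i}+L(I_s\otimes\mathcal C)(\dot P^{n,i}-\dot P^{n,i-1})=G^n\quad\text{in }(\mathcal Q^* )^s,$$ where $\dot U^{n,i}=\tfrac1\tau\mathbb A^{-1}(U^{n,i}-\mathbf 1u^{n-1})$ and $\dot P^{n,i}=\tfrac1\tau\mathbb A^{-1}(P^{n,i}-\mathbf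 1p^{n-1})$. Norm. $\|Q\|_{c,\beta}^2=\sum_{\ell=1}^s\beta_\ell\|Q_\ell\|_c^2$ for stage vectors $Q$.
   Formalization: The estimate is false for i=2 in general; it is proved for all i≥3, and for i=2 only when the initial guess (1u^{n-1}, 1p^{n-1}) satisfies the mechanics equation with right-hand side F^n. *)

theory Defs
  imports "HOL-Analysis.Analysis"
begin

section \<open>Bounded Lipschitz domains\<close>

text \<open>
  Near each boundary point the set is the strict epigraph of a Lipschitz function, in rotated
  coordinates: \<open>e\<close> is the vertical direction and \<open>x - (x \<bullet> e) *\<^sub>R e\<close> the horizontal part of \<open>x\<close>.
\<close>

definition bounded_lipschitz_domain :: "(real^'m::finite) set \<Rightarrow> bool" where
  "bounded_lipschitz_domain \<Omega> \<longleftrightarrow>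
     open \<Omega> \<and> connected \<Omega> \<and> \<Omega> \<noteq> {} \<and> bounded \<Omega> \<and>
     (\<forall>x0 \<in> frontier \<Omega>. \<exists>e N \<gamma> K. norm e = 1 \<and> open N \<and> x0 \<in> N \<and>
        K-lipschitz_on {y. y \<bullet> e = 0} \<gamma> \<and>
        (\<forall>x\<in>N. x \<in> \<Omega> \<longleftrightarrow> (\<gamma> (x - (x \<bullet> e) *\<^sub>R e) :: real) < x \<bullet> e))"


section \<open>Lebesgue and Sobolev spaces\<close>

text \<open>
  Elements of the function spaces are represented by functions on the whole of \<open>real^'m\<close>, of
  which only the restriction to \<open>\<Omega>\<close> matters, and without passing to almost-everywhere classes;
  the norms below are therefore seminorms on representatives. Bilinear forms and functionals
  that are bounded with respect to these seminorms automatically factor through the classes,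
  so equations in dual spaces mean the same as for classes.
\<close>

definition L2_space :: "(real^'m::finite) set \<Rightarrow> (real^'m \<Rightarrow> real) set" where
  "L2_space \<Omega> = {u. u \<in> borel_measurable (lebesgue_on \<Omega>) \<and>
                     integrable (lebesgue_on \<Omega>) (\<lambda>x. (u x)\<^sup>2)}"

definition L2_norm :: "(real^'m::finite) set \<Rightarrow> (real^'m \<Rightarrow> real) \<Rightarrow> real" where
  "L2_norm \<Omega> u = sqrt (integral\<^sup>L (lebesgue_on \<Omega>) (\<lambda>x. (u x)\<^sup>2))"

definition partial_deriv :: "'m \<Rightarrow> (real^'m::finite \<Rightarrow> real) \<Rightarrow> real^'m \<Rightarrow> real" where
  "partial_deriv k f x = frechet_derivative f (at x) (axis k 1)"

fun C_k :: "nat \<Rightarrow> (real^'m::finite \<Rightarrow> real) \<Rightarrow> bool" where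
  "C_k 0 f \<longleftrightarrow> continuous_on UNIV f"
| "C_k (Suc j) f \<longleftrightarrow> (\<forall>x. f differentiable (at x)) \<and> (\<forall>k. C_k j (partial_deriv k f))"

definition test_functions :: "(real^'m::finite) set \<Rightarrow> (real^'m \<Rightarrow> real) set" where
  "test_functions \<Omega> = {\<phi>. (\<forall>j. C_k j \<phi>) \<and>
     compact (closure {x. \<phi> x \<noteq> 0}) \<and> closure {x. \<phi> x \<noteq> 0} \<subseteq> \<Omega>}"

definition weak_gradient ::
  "(real^'m::finite) set \<Rightarrow> (real^'m \<Rightarrow> real) \<Rightarrow> ('m \<Rightarrow> real^'m \<Rightarrow> real) \<Rightarrow> bool" where
  "weak_gradient \<Omega> u g \<longleftrightarrow>
     (\<forall>k. g k \<in> L2_space \<Omega>) \<and>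
     (\<forall>\<phi>\<in>test_functions \<Omega>. \<forall>k.
        integral\<^sup>L (lebesgue_on \<Omega>) (\<lambda>x. u x * partial_deriv k \<phi> x) =
        - integral\<^sup>L (lebesgue_on \<Omega>) (\<lambda>x. g k x * \<phi> x))"

definition H1_norm :: "(real^'m::finite) set \<Rightarrow> (real^'m \<Rightarrow> real) \<Rightarrow> real" where
  "H1_norm \<Omega> u = sqrt ((L2_norm \<Omega> u)\<^sup>2 +
     (\<Sum>k\<in>UNIV. (L2_norm \<Omega> ((SOME g. weak_gradient \<Omega> u g) k))\<^sup>2))"

text \<open>
  The closure of the test functions in \<open>H\<^sup>1(\<Omega>)\<close>, with the \<open>H\<^sup>1\<close> distance between \<open>u\<close> and a test
  function written out in terms of a weak gradient of \<open>u\<close>.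
\<close>

definition H10_space :: "(real^'m::finite) set \<Rightarrow> (real^'m \<Rightarrow> real) set" where
  "H10_space \<Omega> = {u. u \<in> L2_space \<Omega> \<and> (\<exists>g. weak_gradient \<Omega> u g \<and>
     (\<forall>\<epsilon>>0. \<exists>\<phi>\<in>test_functions \<Omega>.
        sqrt ((L2_norm \<Omega> (\<lambda>x. u x - \<phi> x))\<^sup>2 +
              (\<Sum>k\<in>UNIV. (L2_norm \<Omega> (\<lambda>x. g k x - partial_deriv k \<phi> x))\<^sup>2)) < \<epsilon>))}"

definition H10_vec_space :: "(real^'m::finite) set \<Rightarrow> (real^'m \<Rightarrow> real^'m) set" where
  "H10_vec_space \<Omega> = {u. \<forall>k. (\<lambda>x. u x $ k) \<in> H10_space \<Omega>}"

definition H1_vec_norm :: "(real^'m::finite) set \<Rightarrow> (real^'m \<Rightarrow> real^'m) \<Rightarrow> real" where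
  "H1_vec_norm \<Omega> u = sqrt (\<Sum>k\<in>UNIV. (H1_norm \<Omega> (\<lambda>x. u x $ k))\<^sup>2)"


section \<open>Functionals and bilinear forms on function spaces\<close>

definition linear_form_on :: "('x \<Rightarrow> 'v::real_vector) set \<Rightarrow> (('x \<Rightarrow> 'v) \<Rightarrow> real) \<Rightarrow> bool" where
  "linear_form_on S \<phi> \<longleftrightarrow>
     (\<forall>u\<in>S. \<forall>v\<in>S. \<forall>r s. \<phi> (\<lambda>x. r *\<^sub>R u x + s *\<^sub>R v x) = r * \<phi> u + s * \<phi> v)"

definition dual_space ::
  "('x \<Rightarrow> 'v::real_vector) set \<Rightarrow> (('x \<Rightarrow> 'v) \<Rightarrow> real) \<Rightarrow> (('x \<Rightarrow> 'v) \<Rightarrow> real) set" where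
  "dual_space S nrm = {\<phi>. linear_form_on S \<phi> \<and> (\<exists>K. \<forall>u\<in>S. \<bar>\<phi> u\<bar> \<le> K * nrm u)}"

definition bilinear_form_on ::
  "('x \<Rightarrow> 'v::real_vector) set \<Rightarrow> ('y \<Rightarrow> 'w::real_vector) set \<Rightarrow>
   (('x \<Rightarrow> 'v) \<Rightarrow> ('y \<Rightarrow> 'w) \<Rightarrow> real) \<Rightarrow> bool" where
  "bilinear_form_on S T h \<longleftrightarrow>
     (\<forall>u\<in>S. linear_form_on T (h u)) \<and> (\<forall>v\<in>T. linear_form_on S (\<lambda>u. h u v))"

text \<open>Symmetric, continuous and elliptic with ellipticity constant \<open>\<alpha>\<close>.\<close>

definition elliptic_form ::
  "('x \<Rightarrow> 'v::real_vector) set \<Rightarrow> (('x \<Rightarrow> 'v) \<Rightarrow> real) \<Rightarrow>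
   (('x \<Rightarrow> 'v) \<Rightarrow> ('x \<Rightarrow> 'v) \<Rightarrow> real) \<Rightarrow> real \<Rightarrow> bool" where
  "elliptic_form S nrm h \<alpha> \<longleftrightarrow>
     bilinear_form_on S S h \<and>
     (\<forall>u\<in>S. \<forall>v\<in>S. h u v = h v u) \<and>
     (\<exists>K. \<forall>u\<in>S. \<forall>v\<in>S. \<bar>h u v\<bar> \<le> K * nrm u * nrm v) \<and>
     \<alpha> > 0 \<and> (\<forall>u\<in>S. h u u \<ge> \<alpha> * (nrm u)\<^sup>2)"

text \<open>
  Here and below, the operators \<open>\<A>, \<B>, \<C>, \<D>\<close> appear through their forms:
  \<open>\<langle>\<A> u, v\<rangle> = a u v\<close>, \<open>\<langle>\<D> u, q\<rangle> = d u q\<close>, \<open>\<langle>\<D>\<^sup>* p, v\<rangle> = d v p\<close>, and so on.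
  The following relation is the graph \<open>r = \<C>\<^sup>-\<^sup>1 \<D> \<A>\<^sup>-\<^sup>1 \<D>\<^sup>* p\<close>, where \<open>w = \<A>\<^sup>-\<^sup>1 \<D>\<^sup>* p\<close>.
\<close>

definition CinvM_graph ::
  "(real^'m::finite) set \<Rightarrow>
   ((real^'m \<Rightarrow> real^'m) \<Rightarrow> (real^'m \<Rightarrow> real^'m) \<Rightarrow> real) \<Rightarrow>
   ((real^'m \<Rightarrow> real) \<Rightarrow> (real^'m \<Rightarrow> real) \<Rightarrow> real) \<Rightarrow>
   ((real^'m \<Rightarrow> real^'m) \<Rightarrow> (real^'m \<Rightarrow> real) \<Rightarrow> real) \<Rightarrow>
   (real^'m \<Rightarrow> real) \<Rightarrow> (real^'m \<Rightarrow> real) \<Rightarrow> bool" where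
  "CinvM_graph \<Omega> a c d p r \<longleftrightarrow>
     p \<in> L2_space \<Omega> \<and> r \<in> L2_space \<Omega> \<and>
     (\<exists>w\<in>H10_vec_space \<Omega>. (\<forall>v\<in>H10_vec_space \<Omega>. a w v = d v p) \<and>
                           (\<forall>q\<in>L2_space \<Omega>. c r q = d w q))"

definition CinvM_compact ::
  "(real^'m::finite) set \<Rightarrow>
   ((real^'m \<Rightarrow> real^'m) \<Rightarrow> (real^'m \<Rightarrow> real^'m) \<Rightarrow> real) \<Rightarrow>
   ((real^'m \<Rightarrow> real) \<Rightarrow> (real^'m \<Rightarrow> real) \<Rightarrow> real) \<Rightarrow>
   ((real^'m \<Rightarrow> real^'m) \<Rightarrow> (real^'m \<Rightarrow> real) \<Rightarrow> real) \<Rightarrow> bool" where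
  "CinvM_compact \<Omega> a c d \<longleftrightarrow>
     (\<forall>p r :: nat \<Rightarrow> real^'m \<Rightarrow> real.
        (\<exists>K. \<forall>k. L2_norm \<Omega> (p k) \<le> K) \<and> (\<forall>k. CinvM_graph \<Omega> a c d (p k) (r k)) \<longrightarrow>
        (\<exists>\<sigma> :: nat \<Rightarrow> nat. \<exists>r'\<in>L2_space \<Omega>. strict_mono \<sigma> \<and>
           (\<lambda>j. L2_norm \<Omega> (\<lambda>x. r (\<sigma> j) x - r' x)) \<longlonglongrightarrow> 0))"


section \<open>Runge--Kutta methods\<close>

definition RK_nodes :: "real^'s^'s \<Rightarrow> real^'s::finite" where
  "RK_nodes A = A *v 1"

definition complex_vec :: "real^'s \<Rightarrow> complex^'s::finite" where
  "complex_vec v = (\<chi> i. complex_of_real (v $ i))"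

definition complex_mat :: "real^'s^'s \<Rightarrow> complex^'s^'s::finite" where
  "complex_mat A = (\<chi> i j. complex_of_real (A $ i $ j))"

definition RK_stability_matrix :: "real^'s^'s \<Rightarrow> complex \<Rightarrow> complex^'s^'s::finite" where
  "RK_stability_matrix A z = (\<chi> i j. (if i = j then 1 else 0) - z * complex_mat A $ i $ j)"

definition RK_stability_fun :: "real^'s^'s \<Rightarrow> real^'s::finite \<Rightarrow> complex \<Rightarrow> complex" where
  "RK_stability_fun A \<beta> z =
     1 + z * (\<Sum>i\<in>UNIV. complex_vec \<beta> $ i * (matrix_inv (RK_stability_matrix A z) *v 1) $ i)"

definition RK_stability_at_infinity :: "real^'s^'s \<Rightarrow> real^'s::finite \<Rightarrow> real" where
  "RK_stability_at_infinity A \<beta> = 1 - \<beta> \<bullet> (matrix_inv A *v 1)"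

text \<open>
  The finitely many \<open>z\<close> with singular \<open>I - z A\<close>, where the formula for \<open>R(z)\<close> is undefined, are
  excluded. If \<open>R\<close> is bounded by 1 elsewhere in the half-plane, it has no pole there and its
  continuous extension to such points obeys the same bound.
\<close>

definition A_stable :: "real^'s^'s \<Rightarrow> real^'s::finite \<Rightarrow> bool" where
  "A_stable A \<beta> \<longleftrightarrow>
     (\<forall>z. Re z \<le> 0 \<and> invertible (RK_stability_matrix A z) \<longrightarrow> cmod (RK_stability_fun A \<beta> z) \<le> 1)"

definition positive_semidefinite :: "real^'s^'s::finite \<Rightarrow> bool" where
  "positive_semidefinite M \<longleftrightarrow> transpose M = M \<and> (\<forall>x. 0 \<le> x \<bullet> (M *v x))"

definition diag_mat :: "real^'s \<Rightarrow> real^'s^'s::finite" where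
  "diag_mat \<beta> = (\<chi> i j. if i = j then \<beta> $ i else 0)"

definition outer_square :: "real^'s \<Rightarrow> real^'s^'s::finite" where
  "outer_square \<beta> = (\<chi> i j. \<beta> $ i * \<beta> $ j)"

definition algebraically_stable :: "real^'s^'s \<Rightarrow> real^'s::finite \<Rightarrow> bool" where
  "algebraically_stable A \<beta> \<longleftrightarrow>
     positive_semidefinite (diag_mat \<beta> ** A + transpose A ** diag_mat \<beta> - outer_square \<beta>)"


section \<open>The fixed-stress iteration within one time step\<close>

text \<open>
  Stage vectors are families indexed by the finite type \<open>'s\<close>. The \<open>l\<close>-th entry of
  \<open>\<tau>\<^sup>-\<^sup>1 A\<^sup>-\<^sup>1 (W - 1 w)\<close>:
\<close>

definition stage_derivative ::
  "real^'s^'s::finite \<Rightarrow> real \<Rightarrow> ('x \<Rightarrow> 'v::real_vector) \<Rightarrow> ('s \<Rightarrow> 'x \<Rightarrow> 'v) \<Rightarrow> 's \<Rightarrow> 'x \<Rightarrow> 'v" where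
  "stage_derivative A \<tau> w W l x =
     (1 / \<tau>) *\<^sub>R (\<Sum>j\<in>UNIV. (matrix_inv A $ l $ j) *\<^sub>R (W j x - w x))"

definition mechanics_equation ::
  "(real^'m::finite) set \<Rightarrow>
   ((real^'m \<Rightarrow> real^'m) \<Rightarrow> (real^'m \<Rightarrow> real^'m) \<Rightarrow> real) \<Rightarrow>
   ((real^'m \<Rightarrow> real^'m) \<Rightarrow> (real^'m \<Rightarrow> real) \<Rightarrow> real) \<Rightarrow>
   ('s \<Rightarrow> (real^'m \<Rightarrow> real^'m) \<Rightarrow> real) \<Rightarrow>
   ('s \<Rightarrow> real^'m \<Rightarrow> real^'m) \<Rightarrow> ('s \<Rightarrow> real^'m \<Rightarrow> real) \<Rightarrow> bool" where
  "mechanics_equation \<Omega> a d F U P \<longleftrightarrow>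
     (\<forall>l. \<forall>v\<in>H10_vec_space \<Omega>. a (U l) v - d v (P l) = F l v)"

definition flow_equation ::
  "(real^'m::finite) set \<Rightarrow>
   ((real^'m \<Rightarrow> real) \<Rightarrow> (real^'m \<Rightarrow> real) \<Rightarrow> real) \<Rightarrow>
   ((real^'m \<Rightarrow> real) \<Rightarrow> (real^'m \<Rightarrow> real) \<Rightarrow> real) \<Rightarrow>
   ((real^'m \<Rightarrow> real^'m) \<Rightarrow> (real^'m \<Rightarrow> real) \<Rightarrow> real) \<Rightarrow>
   real^'s^'s::finite \<Rightarrow> real \<Rightarrow> real \<Rightarrow>
   (real^'m \<Rightarrow> real^'m) \<Rightarrow> (real^'m \<Rightarrow> real) \<Rightarrow>
   ('s \<Rightarrow> (real^'m \<Rightarrow> real) \<Rightarrow> real) \<Rightarrow>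
   ('s \<Rightarrow> real^'m \<Rightarrow> real^'m) \<Rightarrow> ('s \<Rightarrow> real^'m \<Rightarrow> real) \<Rightarrow> ('s \<Rightarrow> real^'m \<Rightarrow> real) \<Rightarrow> bool" where
  "flow_equation \<Omega> b c d A \<tau> L u p G Uold Pold P \<longleftrightarrow>
     (\<forall>l. \<forall>q\<in>H10_space \<Omega>.
        d (stage_derivative A \<tau> u Uold l) q
        + c (stage_derivative A \<tau> p P l) q
        + b (P l) q
        + L * c (\<lambda>x. stage_derivative A \<tau> p P l x - stage_derivative A \<tau> p Pold l x) q
        = G l q)"

text \<open>
  The mechanics equation is imposed for \<open>i \<ge> 1\<close> only: the initial guess \<open>(1 u, 1 p)\<close> need not
  satisfy it, since \<open>F\<close> contains the load at the new stage times.
\<close>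

definition fixed_stress_iteration ::
  "(real^'m::finite) set \<Rightarrow>
   ((real^'m \<Rightarrow> real^'m) \<Rightarrow> (real^'m \<Rightarrow> real^'m) \<Rightarrow> real) \<Rightarrow>
   ((real^'m \<Rightarrow> real) \<Rightarrow> (real^'m \<Rightarrow> real) \<Rightarrow> real) \<Rightarrow>
   ((real^'m \<Rightarrow> real) \<Rightarrow> (real^'m \<Rightarrow> real) \<Rightarrow> real) \<Rightarrow>
   ((real^'m \<Rightarrow> real^'m) \<Rightarrow> (real^'m \<Rightarrow> real) \<Rightarrow> real) \<Rightarrow>
   real^'s^'s::finite \<Rightarrow> real \<Rightarrow> real \<Rightarrow>
   (real^'m \<Rightarrow> real^'m) \<Rightarrow> (real^'m \<Rightarrow> real) \<Rightarrow>
   ('s \<Rightarrow> (real^'m \<Rightarrow> real^'m) \<Rightarrow> real) \<Rightarrow> ('s \<Rightarrow> (real^'m \<Rightarrow> real) \<Rightarrow> real) \<Rightarrow>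
   (nat \<Rightarrow> 's \<Rightarrow> real^'m \<Rightarrow> real^'m) \<Rightarrow> (nat \<Rightarrow> 's \<Rightarrow> real^'m \<Rightarrow> real) \<Rightarrow> bool" where
  "fixed_stress_iteration \<Omega> a b c d A \<tau> L u p F G U P \<longleftrightarrow>
     U 0 = (\<lambda>l. u) \<and> P 0 = (\<lambda>l. p) \<and>
     (\<forall>i::nat. i \<ge> 1 \<longrightarrow>
        (\<forall>l. U i l \<in> H10_vec_space \<Omega> \<and> P i l \<in> H10_space \<Omega>) \<and>
        mechanics_equation \<Omega> a d F (U i) (P i) \<and>
        flow_equation \<Omega> b c d A \<tau> L u p G (U (i - 1)) (P (i - 1)) (P i))"

definition form_norm :: "('q \<Rightarrow> 'q \<Rightarrow> real) \<Rightarrow> 'q \<Rightarrow> real" where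
  "form_norm c p = sqrt (c p p)"

definition stage_norm :: "('q \<Rightarrow> 'q \<Rightarrow> real) \<Rightarrow> real^'s::finite \<Rightarrow> ('s \<Rightarrow> 'q) \<Rightarrow> real" where
  "stage_norm c \<beta> Q = sqrt (\<Sum>l\<in>UNIV. \<beta> $ l * (form_norm c (Q l))\<^sup>2)"

definition rho_FS :: "real \<Rightarrow> real \<Rightarrow> real" where
  "rho_FS \<omega> L = (GREATEST r. r \<in> (\<lambda>\<mu>. \<bar>L - \<mu>\<bar> / (1 + L)) ` {0..\<omega>})"

end

theory Submission
  imports Defs
begin

text \<open>
  Let \<open>q = P\<^bsup>i\<^esup> - P\<^bsup>i-1\<^esup>\<close> and \<open>e = P\<^bsup>i-1\<^esup> - P\<^bsup>i-2\<^esup>\<close>. Subtracting consecutive flow equations, multiplying by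
  \<open>A\<close> and testing with \<open>\<beta>\<^sub>l q\<^sub>l\<close> leaves a \<open>\<B>\<close>-term which algebraic stability makes nonnegative: the
  trace of a product of two positive semidefinite matrices is nonnegative. It remains to bound the
  form \<open>L c - \<langle>\<M> \<cdot>, \<cdot>\<rangle>\<close> between \<open>e\<close> and \<open>q\<close>. By polarization this only needs its diagonal values, and
  \<open>0 \<le> \<langle>\<M> p, p\<rangle> \<le> \<omega> c(p, p)\<close>. The potentials \<open>\<A>\<^sup>-\<^sup>1 \<D>\<^sup>* e\<close> and \<open>\<A>\<^sup>-\<^sup>1 \<D>\<^sup>* q\<close> are the differences of the
  displacement iterates, so neither the Lax--Milgram lemma nor a spectral decomposition is needed.
\<close>

section \<open>Linear combinations in the function spaces\<close>

text \<open>The combination has literally the shape used in \<open>linear_form_on\<close>, so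
  membership and evaluation facts apply to the same term.\<close>

definition lin_closed :: "('x \<Rightarrow> 'v::real_vector) set \<Rightarrow> bool" where
  "lin_closed S \<longleftrightarrow> (\<forall>u\<in>S. \<forall>v\<in>S. \<forall>r s. (\<lambda>x. r *\<^sub>R u x + s *\<^sub>R v x) \<in> S)"

lemma lin_closedD:
  "lin_closed S \<Longrightarrow> u \<in> S \<Longrightarrow> v \<in> S \<Longrightarrow> (\<lambda>x. r *\<^sub>R u x + s *\<^sub>R v x) \<in> S"
  by (simp add: lin_closed_def)

lemma lin_closed_diff:
  assumes "lin_closed S" "u \<in> S" "v \<in> S"
  shows "(\<lambda>x. u x - v x) \<in> S"
  using lin_closedD[OF assms, of 1 "-1"] by simp

text \<open>The empty set satisfies \<open>lin_closed\<close>, so an empty sum, the zero function,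
  need not lie in \<open>S\<close>; the induction therefore starts from a singleton.\<close>

lemma lin_closed_sum:
  fixes u :: "'i \<Rightarrow> 'x \<Rightarrow> 'v::real_vector"
  assumes "lin_closed S" "finite I" "I \<noteq> {}" "\<And>i. i \<in> I \<Longrightarrow> u i \<in> S"
  shows "(\<lambda>x. \<Sum>i\<in>I. r i *\<^sub>R u i x) \<in> S"
  using assms(2-)
proof (induction I rule: finite_ne_induct)
  case (singleton i)
  then show ?case
    using lin_closedD[OF assms(1), of "u i" "u i" "r i" 0] by simp
next
  case (insert i I)
  then show ?case
    using lin_closedD[OF assms(1), of "u i" "\<lambda>x. \<Sum>i\<in>I. r i *\<^sub>R u i x" "r i" 1] by simp
qed

lemma linear_form_onD:
  "linear_form_on S \<phi> \<Longrightarrow> u \<in> S \<Longrightarrow> v \<in> S \<Longrightarrow>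
    \<phi> (\<lambda>x. r *\<^sub>R u x + s *\<^sub>R v x) = r * \<phi> u + s * \<phi> v"
  by (simp add: linear_form_on_def)

lemma linear_form_on_diff:
  assumes "linear_form_on S \<phi>" "u \<in> S" "v \<in> S"
  shows "\<phi> (\<lambda>x. u x - v x) = \<phi> u - \<phi> v"
  using linear_form_onD[OF assms, of 1 "-1"] by simp

lemma linear_form_on_sum:
  fixes u :: "'i \<Rightarrow> 'x \<Rightarrow> 'v::real_vector"
  assumes "linear_form_on S \<phi>" "lin_closed S" "finite I" "I \<noteq> {}" "\<And>i. i \<in> I \<Longrightarrow> u i \<in> S"
  shows "\<phi> (\<lambda>x. \<Sum>i\<in>I. r i *\<^sub>R u i x) = (\<Sum>i\<in>I. r i * \<phi> (u i))"
  using assms(3-)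
proof (induction I rule: finite_ne_induct)
  case (singleton i)
  then show ?case
    using linear_form_onD[OF assms(1), of "u i" "u i" "r i" 0] by simp
next
  case (insert i I)
  have "(\<lambda>x. \<Sum>i\<in>I. r i *\<^sub>R u i x) \<in> S"
    using insert by (intro lin_closed_sum[OF assms(2)]) auto
  then show ?case
    using insert linear_form_onD[OF assms(1), of "u i" "\<lambda>x. \<Sum>i\<in>I. r i *\<^sub>R u i x" "r i" 1]
    by simp
qed

lemma bilinear_form_onD:
  assumes "bilinear_form_on S T h"
  shows "u \<in> S \<Longrightarrow> linear_form_on T (h u)" "v \<in> T \<Longrightarrow> linear_form_on S (\<lambda>u. h u v)"
  using assms by (auto simp: bilinear_form_on_def)

lemma bilinear_form_on_square:
  assumes h: "bilinear_form_on S S h" and S: "lin_closed S"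
    and u: "u \<in> S" and v: "v \<in> S" and sym: "h u v = h v u"
  shows "h (\<lambda>x. r *\<^sub>R u x + s *\<^sub>R v x) (\<lambda>x. r *\<^sub>R u x + s *\<^sub>R v x)
    = r\<^sup>2 * h u u + 2 * r * s * h u v + s\<^sup>2 * h v v"
proof -
  let ?w = "\<lambda>x. r *\<^sub>R u x + s *\<^sub>R v x"
  have "h ?w ?w = r * h u ?w + s * h v ?w"
    using linear_form_onD[OF bilinear_form_onD(2)[OF h lin_closedD[OF S u v]] u v] .
  also have "h u ?w = r * h u u + s * h u v"
    using linear_form_onD[OF bilinear_form_onD(1)[OF h u] u v] .
  also have "h v ?w = r * h v u + s * h v v"
    using linear_form_onD[OF bilinear_form_onD(1)[OF h v] u v] .
  finally show ?thesis
    by (simp add: sym[symmetric] power2_eq_square algebra_simps)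
qed

text \<open>Turns the quadratic form of the Gram matrix into one value of \<open>h\<close>, so that
  ellipticity of \<open>h\<close> makes the Gram matrix positive semidefinite.\<close>

lemma bilinear_form_on_gram:
  fixes u :: "'i::finite \<Rightarrow> 'x \<Rightarrow> 'v::real_vector"
  assumes h: "bilinear_form_on S S h" and S: "lin_closed S" and u: "\<And>i. u i \<in> S"
  shows "h (\<lambda>x. \<Sum>i\<in>UNIV. r i *\<^sub>R u i x) (\<lambda>x. \<Sum>i\<in>UNIV. r i *\<^sub>R u i x)
    = (\<Sum>i\<in>UNIV. \<Sum>j\<in>UNIV. r i * r j * h (u i) (u j))"
proof -
  let ?w = "\<lambda>x. \<Sum>i\<in>UNIV. r i *\<^sub>R u i x"
  have w: "?w \<in> S"
    by (rule lin_closed_sum[OF S]) (use u in auto)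
  have "h ?w ?w = (\<Sum>i\<in>UNIV. r i * h (u i) ?w)"
    by (rule linear_form_on_sum[OF bilinear_form_onD(2)[OF h w] S]) (use u in auto)
  also have "\<dots> = (\<Sum>i\<in>UNIV. r i * (\<Sum>j\<in>UNIV. r j * h (u i) (u j)))"
    by (intro sum.cong refl arg_cong2[where f="(*)"]
        linear_form_on_sum[OF bilinear_form_onD(1)[OF h u] S]) (use u in auto)
  finally show ?thesis
    by (simp add: sum_distrib_left mult.assoc)
qed

section \<open>Square-integrable functions\<close>

lemma L2_spaceI:
  "u \<in> borel_measurable (lebesgue_on \<Omega>) \<Longrightarrow> integrable (lebesgue_on \<Omega>) (\<lambda>x. (u x)\<^sup>2) \<Longrightarrow>
    u \<in> L2_space \<Omega>"
  by (simp add: L2_space_def)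

lemma L2_spaceD:
  assumes "u \<in> L2_space \<Omega>"
  shows "u \<in> borel_measurable (lebesgue_on \<Omega>)" "integrable (lebesgue_on \<Omega>) (\<lambda>x. (u x)\<^sup>2)"
  using assms by (auto simp: L2_space_def)

lemma L2_space_mult_integrable:
  assumes u: "u \<in> L2_space \<Omega>" and v: "v \<in> L2_space \<Omega>"
  shows "integrable (lebesgue_on \<Omega>) (\<lambda>x. u x * v x)"
proof (rule Bochner_Integration.integrable_bound)
  show "integrable (lebesgue_on \<Omega>) (\<lambda>x. (u x)\<^sup>2 + (v x)\<^sup>2)"
    using L2_spaceD[OF u] L2_spaceD[OF v] by simp
  show "(\<lambda>x. u x * v x) \<in> borel_measurable (lebesgue_on \<Omega>)"
    using L2_spaceD[OF u] L2_spaceD[OF v] by measurable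
  have "\<bar>p * q\<bar> \<le> p\<^sup>2 + q\<^sup>2" for p q :: real
  proof -
    have "2 * (\<bar>p\<bar> * \<bar>q\<bar>) \<le> p\<^sup>2 + q\<^sup>2"
      using sum_squares_bound[of "\<bar>p\<bar>" "\<bar>q\<bar>"] by simp
    moreover have "0 \<le> \<bar>p\<bar> * \<bar>q\<bar>" by simp
    ultimately show ?thesis by (simp only: abs_mult)
  qed
  then show "AE x in lebesgue_on \<Omega>. norm (u x * v x) \<le> norm ((u x)\<^sup>2 + (v x)\<^sup>2)"
    by simp
qed

lemma L2_space_combo:
  assumes u: "u \<in> L2_space \<Omega>" and v: "v \<in> L2_space \<Omega>"
  shows "(\<lambda>x. r * u x + s * v x) \<in> L2_space \<Omega>"
proof (rule L2_spaceI)
  show "(\<lambda>x. r * u x + s * v x) \<in> borel_measurable (lebesgue_on \<Omega>)"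
    using L2_spaceD[OF u] L2_spaceD[OF v] by measurable
  have "integrable (lebesgue_on \<Omega>)
    (\<lambda>x. r\<^sup>2 * (u x)\<^sup>2 + s\<^sup>2 * (v x)\<^sup>2 + 2 * r * s * (u x * v x))"
    using L2_spaceD[OF u] L2_spaceD[OF v] L2_space_mult_integrable[OF u v] by simp
  then show "integrable (lebesgue_on \<Omega>) (\<lambda>x. (r * u x + s * v x)\<^sup>2)"
    by (simp add: power2_sum power_mult_distrib mult_ac)
qed

lemma lin_closed_L2: "lin_closed (L2_space \<Omega>)"
  by (simp add: lin_closed_def L2_space_combo)

lemma L2_norm_square: "(L2_norm \<Omega> u)\<^sup>2 = integral\<^sup>L (lebesgue_on \<Omega>) (\<lambda>x. (u x)\<^sup>2)"
  by (simp add: L2_norm_def)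

text \<open>Pointwise (p + q)^2 \<le> 2 p^2 + 2 q^2 takes the place of Minkowski's inequality: the
  \<open>H10_space\<close> distance is a root of a sum of squared norms, and constants do not matter
  for density.\<close>

lemma L2_norm_combo_le:
  assumes u: "u \<in> L2_space \<Omega>" and v: "v \<in> L2_space \<Omega>"
  shows "(L2_norm \<Omega> (\<lambda>x. r * u x + s * v x))\<^sup>2
    \<le> 2 * r\<^sup>2 * (L2_norm \<Omega> u)\<^sup>2 + 2 * s\<^sup>2 * (L2_norm \<Omega> v)\<^sup>2"
proof -
  have i: "integrable (lebesgue_on \<Omega>) (\<lambda>x. 2 * r\<^sup>2 * (u x)\<^sup>2)"
    "integrable (lebesgue_on \<Omega>) (\<lambda>x. 2 * s\<^sup>2 * (v x)\<^sup>2)"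
    using L2_spaceD[OF u] L2_spaceD[OF v] by simp_all
  have *: "(p + q)\<^sup>2 \<le> 2 * p\<^sup>2 + 2 * q\<^sup>2" for p q :: real
    using sum_squares_bound[of p q] by (simp add: power2_sum)
  have "integral\<^sup>L (lebesgue_on \<Omega>) (\<lambda>x. (r * u x + s * v x)\<^sup>2)
     \<le> integral\<^sup>L (lebesgue_on \<Omega>) (\<lambda>x. 2 * r\<^sup>2 * (u x)\<^sup>2 + 2 * s\<^sup>2 * (v x)\<^sup>2)"
  proof (rule integral_mono)
    show "(r * u x + s * v x)\<^sup>2 \<le> 2 * r\<^sup>2 * (u x)\<^sup>2 + 2 * s\<^sup>2 * (v x)\<^sup>2" for x
      using *[of "r * u x" "s * v x"] by (simp add: power_mult_distrib mult.assoc)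
  qed (use i L2_spaceD(2)[OF L2_space_combo[OF u v]] in auto)
  also have "\<dots> = 2 * r\<^sup>2 * (L2_norm \<Omega> u)\<^sup>2 + 2 * s\<^sup>2 * (L2_norm \<Omega> v)\<^sup>2"
    by (simp add: Bochner_Integration.integral_add[OF i] L2_norm_square)
  finally show ?thesis by (simp add: L2_norm_square)
qed

text \<open>\<open>f\<close> is bounded on the compact closure of \<Omega>, and \<Omega> has finite
  measure.\<close>

lemma continuous_in_L2_space:
  fixes f :: "real^'m::finite \<Rightarrow> real"
  assumes \<Omega>: "open \<Omega>" "bounded \<Omega>" and f: "continuous_on UNIV f"
  shows "f \<in> L2_space \<Omega>"
proof (rule L2_spaceI)
  show m: "f \<in> borel_measurable (lebesgue_on \<Omega>)"
    by (rule continuous_imp_measurable_on_sets_lebesgue)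
      (use f \<Omega> continuous_on_subset in \<open>auto simp: borel_open\<close>)
  have "compact (f ` closure \<Omega>)"
    using \<Omega> f by (intro compact_continuous_image) (auto intro: continuous_on_subset)
  then have "bounded (f ` closure \<Omega>)"
    by (rule compact_imp_bounded)
  then obtain B where "\<forall>y\<in>f ` closure \<Omega>. norm y \<le> B"
    unfolding bounded_iff by blast
  then have B: "\<bar>f x\<bar> \<le> B" if "x \<in> \<Omega>" for x
    using subsetD[OF closure_subset that] by simp
  have fin: "finite_measure (lebesgue_on \<Omega>)"
    by (intro finite_measure_lebesgue_on bounded_set_imp_lmeasurable) (use \<Omega> in \<open>auto simp: borel_open\<close>)
  show "integrable (lebesgue_on \<Omega>) (\<lambda>x. (f x)\<^sup>2)"
  proof (rule finite_measure.integrable_const_bound[OF fin, of _ "B\<^sup>2"])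
    show "AE x in lebesgue_on \<Omega>. norm ((f x)\<^sup>2) \<le> B\<^sup>2"
    proof (rule AE_I2)
      fix x assume "x \<in> space (lebesgue_on \<Omega>)"
      then have "\<bar>f x\<bar>\<^sup>2 \<le> B\<^sup>2"
        by (intro power_mono B) simp_all
      then show "norm ((f x)\<^sup>2) \<le> B\<^sup>2" by simp
    qed
    show "(\<lambda>x. (f x)\<^sup>2) \<in> borel_measurable (lebesgue_on \<Omega>)"
      using m by measurable
  qed
qed

section \<open>Test functions, weak gradients and the space \<open>H10_space\<close>\<close>

lemma partial_deriv_combo:
  assumes "f differentiable (at x)" "g differentiable (at x)"
  shows "partial_deriv k (\<lambda>x. r * f x + s * g x) x = r * partial_deriv k f x + s * partial_deriv k g x"
proof -
  have "((\<lambda>x. r * f x + s * g x) has_derivative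
    (\<lambda>h. r * frechet_derivative f (at x) h + s * frechet_derivative g (at x) h)) (at x)"
    using assms unfolding frechet_derivative_works by (auto intro!: derivative_eq_intros)
  from frechet_derivative_at[OF this, symmetric] show ?thesis
    by (simp add: partial_deriv_def)
qed

lemma C_k_combo:
  assumes "C_k j f" "C_k j g"
  shows "C_k j (\<lambda>x. r * f x + s * g x)"
  using assms
proof (induction j arbitrary: f g)
  case 0
  then show ?case by (auto intro!: continuous_intros)
next
  case (Suc j)
  have "partial_deriv k (\<lambda>x. r * f x + s * g x) = (\<lambda>x. r * partial_deriv k f x + s * partial_deriv k g x)" for k
    using Suc.prems by (intro ext partial_deriv_combo) auto
  with Suc show ?case by (auto intro!: derivative_intros)
qed

lemma test_functionsD:
  assumes "\<phi> \<in> test_functions \<Omega>"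
  shows "continuous_on UNIV \<phi>" "\<phi> differentiable (at x)" "continuous_on UNIV (partial_deriv k \<phi>)"
proof -
  have "C_k 0 \<phi>" "C_k (Suc 0) \<phi>"
    using assms unfolding test_functions_def by blast+
  then show "continuous_on UNIV \<phi>" "\<phi> differentiable (at x)" "continuous_on UNIV (partial_deriv k \<phi>)"
    by auto
qed

lemma test_functions_combo:
  assumes "\<phi> \<in> test_functions \<Omega>" "\<psi> \<in> test_functions \<Omega>"
  shows "(\<lambda>x. r * \<phi> x + s * \<psi> x) \<in> test_functions \<Omega>"
proof -
  let ?K = "closure {x. \<phi> x \<noteq> 0} \<union> closure {x. \<psi> x \<noteq> 0}"
  have K: "compact ?K" "?K \<subseteq> \<Omega>"
    using assms by (auto simp: test_functions_def)
  have "closure {x. r * \<phi> x + s * \<psi> x \<noteq> 0} \<subseteq> closure ({x. \<phi> x \<noteq> 0} \<union> {x. \<psi> x \<noteq> 0})"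
    by (intro closure_mono) auto
  then have *: "closure {x. r * \<phi> x + s * \<psi> x \<noteq> 0} \<subseteq> ?K"
    by (simp add: closure_Un)
  have "compact (?K \<inter> closure {x. r * \<phi> x + s * \<psi> x \<noteq> 0})"
    by (rule compact_Int_closed[OF K(1)]) simp
  with * have "compact (closure {x. r * \<phi> x + s * \<psi> x \<noteq> 0})"
    by (simp add: Int_absorb1)
  with * K assms show ?thesis
    by (auto simp: test_functions_def intro: C_k_combo)
qed

text \<open>The defining identity is linear in the pair of function and gradient once the integrals
  split. All products are integrable because test functions and their derivatives are
  square-integrable on the bounded set \<Omega>.\<close>

lemma weak_gradient_combo:
  assumes \<Omega>: "open \<Omega>" "bounded \<Omega>"
    and u: "u \<in> L2_space \<Omega>" "weak_gradient \<Omega> u g" and v: "v \<in> L2_space \<Omega>" "weak_gradient \<Omega> v h"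
  shows "weak_gradient \<Omega> (\<lambda>x. r * u x + s * v x) (\<lambda>k x. r * g k x + s * h k x)"
  unfolding weak_gradient_def
proof (intro conjI ballI allI)
  have gh: "g k \<in> L2_space \<Omega>" "h k \<in> L2_space \<Omega>" for k
    using u v by (auto simp: weak_gradient_def)
  then show "(\<lambda>x. r * g k x + s * h k x) \<in> L2_space \<Omega>" for k
    by (intro L2_space_combo)
  fix \<phi> k assume \<phi>: "\<phi> \<in> test_functions \<Omega>"
  let ?I = "\<lambda>f. integral\<^sup>L (lebesgue_on \<Omega>) f"
  have \<phi>2: "\<phi> \<in> L2_space \<Omega>" "partial_deriv k \<phi> \<in> L2_space \<Omega>"
    using test_functionsD[OF \<phi>] \<Omega> by (auto intro: continuous_in_L2_space)
  have lin: "?I (\<lambda>x. (r * f1 x + s * f2 x) * q x) = r * ?I (\<lambda>x. f1 x * q x) + s * ?I (\<lambda>x. f2 x * q x)"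
    if "f1 \<in> L2_space \<Omega>" "f2 \<in> L2_space \<Omega>" "q \<in> L2_space \<Omega>" for f1 f2 q
    using that by (simp add: distrib_right mult.assoc L2_space_mult_integrable)
  have "?I (\<lambda>x. u x * partial_deriv k \<phi> x) = - ?I (\<lambda>x. g k x * \<phi> x)"
    "?I (\<lambda>x. v x * partial_deriv k \<phi> x) = - ?I (\<lambda>x. h k x * \<phi> x)"
    using u v \<phi> by (auto simp: weak_gradient_def)
  then show "?I (\<lambda>x. (r * u x + s * v x) * partial_deriv k \<phi> x)
    = - ?I (\<lambda>x. (r * g k x + s * h k x) * \<phi> x)"
    by (simp add: lin u v \<phi>2 gh)
qed

lemma H10_space_subset: "H10_space \<Omega> \<subseteq> L2_space \<Omega>"
  by (auto simp: H10_space_def)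

text \<open>If \<phi> approximates \<open>u\<close> and \<psi> approximates \<open>v\<close>, then r
  \<phi> + s \<psi> approximates the combination, measured with the weak gradient r g + s h.\<close>

lemma lin_closed_H10:
  fixes \<Omega> :: "(real^'m::finite) set"
  assumes \<Omega>: "open \<Omega>" "bounded \<Omega>"
  shows "lin_closed (H10_space \<Omega>)"
  unfolding lin_closed_def
proof (intro ballI allI)
  fix u v :: "real^'m \<Rightarrow> real" and r s :: real
  assume "u \<in> H10_space \<Omega>" "v \<in> H10_space \<Omega>"
  define D where "D = (\<lambda>u g \<phi>. (L2_norm \<Omega> (\<lambda>x. u x - \<phi> x))\<^sup>2 +
    (\<Sum>k\<in>UNIV. (L2_norm \<Omega> (\<lambda>x. g k x - partial_deriv k \<phi> x))\<^sup>2))"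
  obtain g h where u: "u \<in> L2_space \<Omega>" "weak_gradient \<Omega> u g"
    and ua: "\<And>\<epsilon>. \<epsilon> > 0 \<Longrightarrow> \<exists>\<phi>\<in>test_functions \<Omega>. sqrt (D u g \<phi>) < \<epsilon>"
    and v: "v \<in> L2_space \<Omega>" "weak_gradient \<Omega> v h"
    and va: "\<And>\<epsilon>. \<epsilon> > 0 \<Longrightarrow> \<exists>\<phi>\<in>test_functions \<Omega>. sqrt (D v h \<phi>) < \<epsilon>"
    using \<open>u \<in> H10_space \<Omega>\<close> \<open>v \<in> H10_space \<Omega>\<close> unfolding H10_space_def D_def by blast
  let ?w = "\<lambda>x. r * u x + s * v x" and ?gh = "\<lambda>k x. r * g k x + s * h k x"
  have gh: "g k \<in> L2_space \<Omega>" "h k \<in> L2_space \<Omega>" for k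
    using u v by (auto simp: weak_gradient_def)
  have D: "D ?w ?gh (\<lambda>x. r * \<phi> x + s * \<psi> x) \<le> 2 * r\<^sup>2 * D u g \<phi> + 2 * s\<^sup>2 * D v h \<psi>"
    if \<phi>: "\<phi> \<in> test_functions \<Omega>" and \<psi>: "\<psi> \<in> test_functions \<Omega>" for \<phi> \<psi>
  proof -
    have le: "(L2_norm \<Omega> (\<lambda>x. (r * f1 x + s * f2 x) - (r * q1 x + s * q2 x)))\<^sup>2
      \<le> 2 * r\<^sup>2 * (L2_norm \<Omega> (\<lambda>x. f1 x - q1 x))\<^sup>2 + 2 * s\<^sup>2 * (L2_norm \<Omega> (\<lambda>x. f2 x - q2 x))\<^sup>2"
      if "f1 \<in> L2_space \<Omega>" "f2 \<in> L2_space \<Omega>" "q1 \<in> L2_space \<Omega>" "q2 \<in> L2_space \<Omega>" for f1 f2 q1 q2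
      using L2_norm_combo_le[OF lin_closed_diff[OF lin_closed_L2 that(1,3)]
          lin_closed_diff[OF lin_closed_L2 that(2,4)], of r s]
      by (simp add: algebra_simps)
    have pd: "partial_deriv k (\<lambda>x. r * \<phi> x + s * \<psi> x) x = r * partial_deriv k \<phi> x + s * partial_deriv k \<psi> x" for k x
      by (intro partial_deriv_combo test_functionsD[OF \<phi>] test_functionsD[OF \<psi>])
    have m: "\<phi> \<in> L2_space \<Omega>" "\<psi> \<in> L2_space \<Omega>"
      "partial_deriv k \<phi> \<in> L2_space \<Omega>" "partial_deriv k \<psi> \<in> L2_space \<Omega>" for k
      by (intro continuous_in_L2_space \<Omega> test_functionsD[OF \<phi>] test_functionsD[OF \<psi>])+
    have "D ?w ?gh (\<lambda>x. r * \<phi> x + s * \<psi> x) \<le>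
      (2 * r\<^sup>2 * (L2_norm \<Omega> (\<lambda>x. u x - \<phi> x))\<^sup>2 + 2 * s\<^sup>2 * (L2_norm \<Omega> (\<lambda>x. v x - \<psi> x))\<^sup>2) +
      (\<Sum>k\<in>UNIV. 2 * r\<^sup>2 * (L2_norm \<Omega> (\<lambda>x. g k x - partial_deriv k \<phi> x))\<^sup>2
         + 2 * s\<^sup>2 * (L2_norm \<Omega> (\<lambda>x. h k x - partial_deriv k \<psi> x))\<^sup>2)"
      unfolding D_def pd by (intro add_mono sum_mono le) (use u v gh m in auto)
    also have "\<dots> = 2 * r\<^sup>2 * D u g \<phi> + 2 * s\<^sup>2 * D v h \<psi>"
      by (simp add: D_def sum.distrib sum_distrib_left distrib_left)
    finally show ?thesis .
  qed
  have "\<exists>\<eta>\<in>test_functions \<Omega>. sqrt (D ?w ?gh \<eta>) < \<epsilon>" if "\<epsilon> > 0" for \<epsilon>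
  proof -
    \<comment> \<open>The summand 1 keeps \<open>K\<close> positive for r = s = 0 and makes the
      final bound (K - 1) \<epsilon>^2 / K strictly smaller than \<epsilon>^2. The choice of
      \<delta> turns closeness into a bound \<epsilon>^2 / K on the squared distances.\<close>
    define K where "K = 2 * r\<^sup>2 + 2 * s\<^sup>2 + 1"
    have K: "K > 0" unfolding K_def by (intro add_nonneg_pos add_nonneg_nonneg) auto
    define \<delta> where "\<delta> = sqrt (\<epsilon>\<^sup>2 / K)"
    have "\<delta> > 0" using K that by (simp add: \<delta>_def)
    then obtain \<phi> \<psi> where \<phi>: "\<phi> \<in> test_functions \<Omega>" "sqrt (D u g \<phi>) < \<delta>"
      and \<psi>: "\<psi> \<in> test_functions \<Omega>" "sqrt (D v h \<psi>) < \<delta>"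
      using ua va by blast
    have "D u g \<phi> \<le> \<epsilon>\<^sup>2 / K" "D v h \<psi> \<le> \<epsilon>\<^sup>2 / K"
      using \<phi>(2) \<psi>(2) by (simp_all add: \<delta>_def)
    then have "2 * r\<^sup>2 * D u g \<phi> + 2 * s\<^sup>2 * D v h \<psi> \<le> 2 * r\<^sup>2 * (\<epsilon>\<^sup>2 / K) + 2 * s\<^sup>2 * (\<epsilon>\<^sup>2 / K)"
      by (intro add_mono mult_left_mono) auto
    also have "\<dots> = (K - 1) * (\<epsilon>\<^sup>2 / K)"
      by (simp add: K_def algebra_simps add_divide_distrib)
    also have "\<dots> < K * (\<epsilon>\<^sup>2 / K)"
      using K that by (intro mult_strict_right_mono) auto
    also have "\<dots> = \<epsilon>\<^sup>2" using K by simp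
    finally have "D ?w ?gh (\<lambda>x. r * \<phi> x + s * \<psi> x) < \<epsilon>\<^sup>2"
      using D[OF \<phi>(1) \<psi>(1)] by simp
    then have "sqrt (D ?w ?gh (\<lambda>x. r * \<phi> x + s * \<psi> x)) < \<epsilon>"
      using that real_sqrt_less_mono by fastforce
    with test_functions_combo[OF \<phi>(1) \<psi>(1)] show ?thesis by blast
  qed
  moreover have "?w \<in> L2_space \<Omega>" "weak_gradient \<Omega> ?w ?gh"
    using L2_space_combo[OF u(1) v(1)] weak_gradient_combo[OF \<Omega> u v] by auto
  ultimately show "(\<lambda>x. r *\<^sub>R u x + s *\<^sub>R v x) \<in> H10_space \<Omega>"
    unfolding H10_space_def D_def by auto
qed

lemma lin_closed_H10_vec:
  assumes "open \<Omega>" "bounded \<Omega>"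
  shows "lin_closed (H10_vec_space \<Omega>)"
  using lin_closed_H10[OF assms] by (auto simp: lin_closed_def H10_vec_space_def)


section \<open>Positivity of the Runge--Kutta form\<close>

lemma sum_insert_symmetric:
  fixes f :: "'i \<Rightarrow> 'i \<Rightarrow> real"
  assumes "finite I" "k \<notin> I" and sym: "\<And>i j. f i j = f j i"
  shows "(\<Sum>i\<in>insert k I. \<Sum>j\<in>insert k I. f i j)
    = f k k + 2 * (\<Sum>j\<in>I. f k j) + (\<Sum>i\<in>I. \<Sum>j\<in>I. f i j)"
proof -
  have "(\<Sum>i\<in>I. f i k) = (\<Sum>j\<in>I. f k j)"
    by (intro sum.cong refl sym)
  then show ?thesis
    using assms(1,2) by (simp add: sum.distrib)
qed

text \<open>Induction on the index set: splitting off the rank one matrix \<open>N k i * N k j / N k k\<close> leaves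
  the Schur complement of the pivot \<open>N k k\<close>. For \<open>N k k = 0\<close> the \<open>k\<close>-th row vanishes, which fits
  the same formulas since division by zero gives zero.\<close>

lemma psd_trace_nonneg:
  fixes N B :: "'i \<Rightarrow> 'i \<Rightarrow> real"
  assumes "finite I"
    and "\<And>i j. N i j = N j i" and "\<And>x. 0 \<le> (\<Sum>i\<in>I. \<Sum>j\<in>I. x i * x j * N i j)"
    and "\<And>i j. B i j = B j i" and "\<And>x. 0 \<le> (\<Sum>i\<in>I. \<Sum>j\<in>I. x i * x j * B i j)"
  shows "0 \<le> (\<Sum>i\<in>I. \<Sum>j\<in>I. N i j * B i j)"
  using assms
proof (induction I arbitrary: N rule: finite_induct)
  case empty
  then show ?case by simp
next
  case (insert k I)
  note symN = insert.prems(1) and posN = insert.prems(2) and symB = insert.prems(3) and posB = insert.prems(4)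
  note split = sum_insert_symmetric[OF insert.hyps]
  have psd: "0 \<le> (x k)\<^sup>2 * N k k + 2 * x k * (\<Sum>j\<in>I. x j * N k j) + (\<Sum>i\<in>I. \<Sum>j\<in>I. x i * x j * N i j)" for x
  proof -
    have "(\<Sum>i\<in>insert k I. \<Sum>j\<in>insert k I. x i * x j * N i j)
      = x k * x k * N k k + 2 * (\<Sum>j\<in>I. x k * x j * N k j) + (\<Sum>i\<in>I. \<Sum>j\<in>I. x i * x j * N i j)"
      by (rule split) (metis symN mult.commute)
    with posN[of x] show ?thesis
      by (simp add: sum_distrib_left power2_eq_square mult.assoc)
  qed
  \<comment> \<open>A vector on \<open>I\<close> is extended by zero at \<open>k\<close>, so
    \<open>B\<close> stays positive semidefinite on the smaller index set; only \<open>N\<close> is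
    modified by the induction.\<close>
  have psdB: "0 \<le> (\<Sum>i\<in>I. \<Sum>j\<in>I. x i * x j * B i j)" for x
  proof -
    let ?y = "x(k := 0)"
    have "(\<Sum>i\<in>insert k I. \<Sum>j\<in>insert k I. ?y i * ?y j * B i j) =
      ?y k * ?y k * B k k + 2 * (\<Sum>j\<in>I. ?y k * ?y j * B k j) + (\<Sum>i\<in>I. \<Sum>j\<in>I. ?y i * ?y j * B i j)"
      by (rule split) (metis symB mult.commute)
    moreover have "(\<Sum>i\<in>I. \<Sum>j\<in>I. ?y i * ?y j * B i j) = (\<Sum>i\<in>I. \<Sum>j\<in>I. x i * x j * B i j)"
      using insert.hyps by (intro sum.cong) auto
    ultimately show ?thesis using posB[of ?y] by simp
  qed
  have Nk: "0 \<le> N k k"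
    using psd[of "\<lambda>i. if i = k then 1 else 0"] insert.hyps by (simp add: sum.neutral)
  have N0: "N k j = 0" if "N k k = 0" "j \<in> I" for j
  proof (rule ccontr)
    assume "N k j \<noteq> 0"
    \<comment> \<open>With a zero pivot the form is affine in the coordinate at \<open>k\<close>.
      This \<open>t\<close>, with 1 at \<open>j\<close> and 0 elsewhere, gives it the value
      -1.\<close>
    define t where "t = - (N j j + 1) / (2 * N k j)"
    let ?x = "\<lambda>i. if i = k then t else if i = j then 1 else 0"
    have "j \<noteq> k" using that insert.hyps by auto
    have x: "?x i = (if i = j then 1 else 0)" if "i \<in> I" for i
      using that insert.hyps by auto
    have 1: "(\<Sum>i\<in>I. ?x i * N k i) = N k j"
      using insert.hyps \<open>j \<in> I\<close> by (simp add: x if_distrib[of "\<lambda>a. a * _"] cong: sum.cong if_cong)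
    have 2: "(\<Sum>i\<in>I. \<Sum>l\<in>I. ?x i * ?x l * N i l) = N j j"
      using insert.hyps \<open>j \<in> I\<close> by (simp add: x if_distrib[of "\<lambda>a. a * _"] if_distrib[of "(*) _"] cong: sum.cong if_cong)
    have "0 \<le> 2 * t * N k j + N j j"
      using psd[of ?x] \<open>N k k = 0\<close> unfolding 1 2 by simp
    then show False using \<open>N k j \<noteq> 0\<close> by (simp add: t_def field_simps)
  qed
  define N' where "N' = (\<lambda>i j. N i j - N k i * N k j / N k k)"
  have "0 \<le> (\<Sum>i\<in>I. \<Sum>j\<in>I. N' i j * B i j)"
  proof (rule insert.IH)
    show "N' i j = N' j i" for i j
      by (simp add: N'_def symN[of i j] mult.commute)
    show "0 \<le> (\<Sum>i\<in>I. \<Sum>j\<in>I. x i * x j * N' i j)" for x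
    proof -
      define m where "m = (\<Sum>j\<in>I. x j * N k j)"
      \<comment> \<open>The coordinate at \<open>k\<close> that minimizes the form of
        \<open>N\<close> for fixed \<open>x\<close> on \<open>I\<close>; the minimum is the form of
        the Schur complement at \<open>x\<close>.\<close>
      let ?y = "x(k := - m / N k k)"
      have y: "(\<Sum>j\<in>I. ?y j * N k j) = m"
        "(\<Sum>i\<in>I. \<Sum>j\<in>I. ?y i * ?y j * N i j) = (\<Sum>i\<in>I. \<Sum>j\<in>I. x i * x j * N i j)"
        unfolding m_def using insert.hyps by (auto intro!: sum.cong)
      have "(\<Sum>i\<in>I. \<Sum>j\<in>I. x i * x j * N' i j)
        = (\<Sum>i\<in>I. \<Sum>j\<in>I. x i * x j * N i j) - (\<Sum>i\<in>I. \<Sum>j\<in>I. (x i * N k i) * (x j * N k j)) / N k k"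
        by (simp add: N'_def sum_subtractf sum_divide_distrib right_diff_distrib mult_ac)
      also have "(\<Sum>i\<in>I. \<Sum>j\<in>I. (x i * N k i) * (x j * N k j)) = m\<^sup>2"
        by (simp add: m_def power2_eq_square sum_product)
      also have "(\<Sum>i\<in>I. \<Sum>j\<in>I. x i * x j * N i j) - m\<^sup>2 / N k k =
        (?y k)\<^sup>2 * N k k + 2 * ?y k * m + (\<Sum>i\<in>I. \<Sum>j\<in>I. x i * x j * N i j)"
        by (cases "N k k = 0") (auto simp: field_simps power2_eq_square)
      also have "\<dots> \<ge> 0" using psd[of ?y] unfolding y .
      finally show ?thesis .
    qed
  qed (use symB psdB in auto)
  \<comment> \<open>The rank one part contributes the form of \<open>B\<close> at the pivot row of
    \<open>N\<close>, divided by the nonnegative pivot.\<close>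
  moreover have "(\<Sum>i\<in>insert k I. \<Sum>j\<in>insert k I. N i j * B i j)
    = (\<Sum>i\<in>I. \<Sum>j\<in>I. N' i j * B i j)
      + (\<Sum>i\<in>insert k I. \<Sum>j\<in>insert k I. N k i * N k j * B i j) / N k k"
  proof -
    have 1: "(\<Sum>i\<in>insert k I. \<Sum>j\<in>insert k I. N i j * B i j)
      = N k k * B k k + 2 * (\<Sum>j\<in>I. N k j * B k j) + (\<Sum>i\<in>I. \<Sum>j\<in>I. N i j * B i j)"
      by (rule split) (metis symN symB)
    have 2: "(\<Sum>i\<in>insert k I. \<Sum>j\<in>insert k I. N k i * N k j * B i j)
      = N k k * N k k * B k k + 2 * (\<Sum>j\<in>I. N k k * N k j * B k j) + (\<Sum>i\<in>I. \<Sum>j\<in>I. N k i * N k j * B i j)"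
      by (rule split) (metis symB mult.commute)
    have 3: "(\<Sum>i\<in>I. \<Sum>j\<in>I. N' i j * B i j)
      = (\<Sum>i\<in>I. \<Sum>j\<in>I. N i j * B i j) - (\<Sum>i\<in>I. \<Sum>j\<in>I. N k i * N k j * B i j) / N k k"
      by (simp add: N'_def left_diff_distrib sum_subtractf sum_divide_distrib)
    have 4: "(\<Sum>j\<in>I. N k k * N k j * B k j) = N k k * (\<Sum>j\<in>I. N k j * B k j)"
      by (simp add: sum_distrib_left mult.assoc)
    show ?thesis
    proof (cases "N k k = 0")
      case True
      then have "(\<Sum>j\<in>I. N k j * B k j) = 0"
        by (simp add: N0)
      with True show ?thesis unfolding 1 3 by simp
    next
      case False
      then show ?thesis unfolding 1 2 3 4 by (simp add: field_simps)
    qed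
  qed
  moreover have "0 \<le> (\<Sum>i\<in>insert k I. \<Sum>j\<in>insert k I. N k i * N k j * B i j)"
    by (rule posB)
  ultimately show ?case using Nk by simp
qed

text \<open>Pairing the stability matrix with the symmetric \<open>B\<close> gives twice the claimed
  sum minus the form of \<open>B\<close> at \<beta>. The pairing is nonnegative by
  \<open>psd_trace_nonneg\<close>, and so is the form of \<open>B\<close> at \<beta>.\<close>

lemma algebraically_stable_gram_nonneg:
  fixes A :: "real^'s^'s::finite"
  assumes stable: "algebraically_stable A \<beta>"
    and sym: "\<And>l j. B l j = B j l" and pos: "\<And>x. 0 \<le> (\<Sum>l\<in>UNIV. \<Sum>j\<in>UNIV. x l * x j * B l j)"
  shows "0 \<le> (\<Sum>l\<in>UNIV. \<Sum>j\<in>UNIV. \<beta> $ l * A $ l $ j * B l j)"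
proof -
  define N where "N = diag_mat \<beta> ** A + transpose A ** diag_mat \<beta> - outer_square \<beta>"
  have Nij: "N $ l $ j = \<beta> $ l * A $ l $ j + \<beta> $ j * A $ j $ l - \<beta> $ l * \<beta> $ j" for l j
    by (simp add: N_def matrix_matrix_mult_def diag_mat_def outer_square_def transpose_def
        if_distrib[of "\<lambda>a. a * _"] if_distrib[of "(*) _"] cong: if_cong)
  have psd: "0 \<le> x \<bullet> (N *v x)" for x
    using stable by (simp add: algebraically_stable_def positive_semidefinite_def N_def)
  have "0 \<le> (\<Sum>l\<in>UNIV. \<Sum>j\<in>UNIV. N $ l $ j * B l j)"
  proof (rule psd_trace_nonneg)
    show "0 \<le> (\<Sum>l\<in>UNIV. \<Sum>j\<in>UNIV. x l * x j * N $ l $ j)" for x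
      using psd[of "vec_lambda x"]
      by (simp add: inner_vec_def matrix_vector_mult_def sum_distrib_left mult_ac)
  qed (use sym pos in \<open>auto simp: Nij algebra_simps\<close>)
  also have "\<dots> = (\<Sum>l\<in>UNIV. \<Sum>j\<in>UNIV. \<beta> $ l * A $ l $ j * B l j)
    + (\<Sum>l\<in>UNIV. \<Sum>j\<in>UNIV. \<beta> $ j * A $ j $ l * B l j) - (\<Sum>l\<in>UNIV. \<Sum>j\<in>UNIV. \<beta> $ l * \<beta> $ j * B l j)"
    by (simp add: Nij algebra_simps sum.distrib sum_subtractf)
  also have "(\<Sum>l\<in>UNIV. \<Sum>j\<in>UNIV. \<beta> $ j * A $ j $ l * B l j)
    = (\<Sum>l\<in>UNIV. \<Sum>j\<in>UNIV. \<beta> $ l * A $ l $ j * B l j)"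
    by (subst sum.swap) (simp add: sym)
  finally show ?thesis using pos[of "($) \<beta>"] by simp
qed

section \<open>The fixed-stress iteration\<close>

lemma elliptic_formD:
  assumes "elliptic_form S nrm h \<alpha>"
  shows "bilinear_form_on S S h" "\<And>u v. u \<in> S \<Longrightarrow> v \<in> S \<Longrightarrow> h u v = h v u" "\<alpha> > 0"
    "\<And>u. u \<in> S \<Longrightarrow> \<alpha> * (nrm u)\<^sup>2 \<le> h u u" "\<And>u. u \<in> S \<Longrightarrow> 0 \<le> h u u"
proof -
  show "bilinear_form_on S S h" "\<And>u v. u \<in> S \<Longrightarrow> v \<in> S \<Longrightarrow> h u v = h v u" "\<alpha> > 0"
    "\<And>u. u \<in> S \<Longrightarrow> \<alpha> * (nrm u)\<^sup>2 \<le> h u u"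
    using assms by (auto simp: elliptic_form_def)
  then show "\<And>u. u \<in> S \<Longrightarrow> 0 \<le> h u u"
    by (meson less_eq_real_def mult_nonneg_nonneg order_trans zero_le_power2)
qed

lemma stage_derivative_form:
  fixes A :: "real^'s^'s::finite"
  assumes \<phi>: "linear_form_on S \<phi>" and S: "lin_closed S" and w: "w \<in> S" and W: "\<And>j. W j \<in> S"
  shows "stage_derivative A \<tau> w W l \<in> S"
    and "\<phi> (stage_derivative A \<tau> w W l) = (\<Sum>j\<in>UNIV. (matrix_inv A $ l $ j / \<tau>) * (\<phi> (W j) - \<phi> w))"
proof -
  have eq: "stage_derivative A \<tau> w W l = (\<lambda>x. \<Sum>j\<in>UNIV. (matrix_inv A $ l $ j / \<tau>) *\<^sub>R (W j x - w x))"
    by (simp add: stage_derivative_def fun_eq_iff scaleR_sum_right)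
  have *: "(\<lambda>x. W j x - w x) \<in> S" for j
    by (rule lin_closed_diff[OF S W w])
  show "stage_derivative A \<tau> w W l \<in> S"
    unfolding eq by (rule lin_closed_sum[OF S]) (use * in auto)
  show "\<phi> (stage_derivative A \<tau> w W l) = (\<Sum>j\<in>UNIV. (matrix_inv A $ l $ j / \<tau>) * (\<phi> (W j) - \<phi> w))"
    unfolding eq
    by (subst linear_form_on_sum[OF \<phi> S]) (use * linear_form_on_diff[OF \<phi> W w] in auto)
qed

text \<open>Subtraction cancels the load \<open>G\<close> and the old values \<open>u\<close> and
  \<open>p\<close>; multiplication by \<tau> A undoes the stage derivative, so that only the
  \<open>b\<close> term still couples the stages.\<close>

lemma flow_equation_difference:
  fixes A :: "real^'s^'s::finite"
  assumes \<Omega>: "open \<Omega>" "bounded \<Omega>"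
    and b: "bilinear_form_on (H10_space \<Omega>) (H10_space \<Omega>) b"
    and c: "bilinear_form_on (L2_space \<Omega>) (L2_space \<Omega>) c"
    and d: "bilinear_form_on (H10_vec_space \<Omega>) (L2_space \<Omega>) d"
    and A: "invertible A" and \<tau>: "\<tau> > 0"
    and u: "u \<in> H10_vec_space \<Omega>" "\<And>l. U0 l \<in> H10_vec_space \<Omega>" "\<And>l. U1 l \<in> H10_vec_space \<Omega>"
    and p: "p \<in> H10_space \<Omega>" "\<And>l. P0 l \<in> H10_space \<Omega>" "\<And>l. P1 l \<in> H10_space \<Omega>" "\<And>l. P2 l \<in> H10_space \<Omega>"
    and flow1: "flow_equation \<Omega> b c d A \<tau> L u p G U0 P0 P1"
    and flow2: "flow_equation \<Omega> b c d A \<tau> L u p G U1 P1 P2"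
    and q: "q \<in> H10_space \<Omega>"
  shows "(1 + L) * c (\<lambda>x. P2 m x - P1 m x) q + \<tau> * (\<Sum>l\<in>UNIV. A $ m $ l * b (\<lambda>x. P2 l x - P1 l x) q)
    = L * c (\<lambda>x. P1 m x - P0 m x) q - d (\<lambda>x. U1 m x - U0 m x) q"
proof -
  have qL: "q \<in> L2_space \<Omega>" using q H10_space_subset by auto
  have pL: "p \<in> L2_space \<Omega>" "P0 l \<in> L2_space \<Omega>" "P1 l \<in> L2_space \<Omega>" "P2 l \<in> L2_space \<Omega>" for l
    using p H10_space_subset by blast+
  note bq = bilinear_form_onD(2)[OF b q]
  note cq = bilinear_form_onD(2)[OF c qL]
  note dq = bilinear_form_onD(2)[OF d qL]
  let ?I = "\<lambda>l j. matrix_inv A $ l $ j / \<tau>"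
  \<comment> \<open>All stage derivatives share the coefficients of the inverse matrix. The factor 1
    + L joins the storage term with the implicit half of the stabilization.\<close>
  have flow: "(\<Sum>j\<in>UNIV. ?I l j * (d (V j) q - d u q + (1 + L) * (c (R' j) q - c p q) - L * (c (R j) q - c p q)))
      + b (R' l) q = G l q"
    if V: "\<And>l. V l \<in> H10_vec_space \<Omega>" and R: "\<And>l. R l \<in> L2_space \<Omega>" and R': "\<And>l. R' l \<in> L2_space \<Omega>"
      and "flow_equation \<Omega> b c d A \<tau> L u p G V R R'" for V R R' l
  proof -
    note sd = stage_derivative_form[OF cq lin_closed_L2 pL(1)]
    have "G l q = d (stage_derivative A \<tau> u V l) q + c (stage_derivative A \<tau> p R' l) q + b (R' l) q
      + L * c (\<lambda>x. stage_derivative A \<tau> p R' l x - stage_derivative A \<tau> p R l x) q"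
      using that(4) q by (simp add: flow_equation_def)
    also have "c (\<lambda>x. stage_derivative A \<tau> p R' l x - stage_derivative A \<tau> p R l x) q
      = c (stage_derivative A \<tau> p R' l) q - c (stage_derivative A \<tau> p R l) q"
      by (rule linear_form_on_diff[OF cq sd(1)[OF R'] sd(1)[OF R]])
    finally have G: "G l q = (\<Sum>j\<in>UNIV. ?I l j * (d (V j) q - d u q))
      + (\<Sum>j\<in>UNIV. ?I l j * (c (R' j) q - c p q)) + b (R' l) q
      + L * ((\<Sum>j\<in>UNIV. ?I l j * (c (R' j) q - c p q)) - (\<Sum>j\<in>UNIV. ?I l j * (c (R j) q - c p q)))"
      unfolding stage_derivative_form(2)[OF dq lin_closed_H10_vec[OF \<Omega>] u(1) V] sd(2)[OF R] sd(2)[OF R'] .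
    have "(\<Sum>j\<in>UNIV. ?I l j * (d (V j) q - d u q + (1 + L) * (c (R' j) q - c p q) - L * (c (R j) q - c p q)))
      = (\<Sum>j\<in>UNIV. ?I l j * (d (V j) q - d u q)) + (\<Sum>j\<in>UNIV. ?I l j * (c (R' j) q - c p q))
        + L * (\<Sum>j\<in>UNIV. ?I l j * (c (R' j) q - c p q)) - L * (\<Sum>j\<in>UNIV. ?I l j * (c (R j) q - c p q))"
      unfolding sum_distrib_left sum.distrib[symmetric] sum_subtractf[symmetric]
      by (intro sum.cong refl) (simp only: distrib_right distrib_left right_diff_distrib mult_1 mult.left_commute)
    with G show ?thesis by (simp only: right_diff_distrib)
  qed
  \<comment> \<open>\<open>Y\<close> is what the inverse matrix acts on in the subtracted equations,
    and \<open>Z\<close> is the remaining elliptic term.\<close>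
  define Y where "Y = (\<lambda>j. d (\<lambda>x. U1 j x - U0 j x) q + (1 + L) * c (\<lambda>x. P2 j x - P1 j x) q
    - L * c (\<lambda>x. P1 j x - P0 j x) q)"
  define Z where "Z = (\<lambda>l. b (\<lambda>x. P2 l x - P1 l x) q)"
  define E where "E = (\<lambda>V R R' (j::'s). d (V j) q - d u q + (1 + L) * (c (R' j) q - c p q) - L * (c (R j) q - c p q))"
  have Y: "Y j = E U1 P1 P2 j - E U0 P0 P1 j" for j
    by (simp add: Y_def E_def linear_form_on_diff[OF dq u(3) u(2)] linear_form_on_diff[OF cq pL(4) pL(3)]
        linear_form_on_diff[OF cq pL(3) pL(2)] algebra_simps)
  have YZ: "(\<Sum>j\<in>UNIV. ?I l j * Y j) + Z l = 0" for l
  proof -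
    have "(\<Sum>j\<in>UNIV. ?I l j * Y j) = (\<Sum>j\<in>UNIV. ?I l j * E U1 P1 P2 j) - (\<Sum>j\<in>UNIV. ?I l j * E U0 P0 P1 j)"
      by (simp only: Y right_diff_distrib sum_subtractf)
    moreover have "Z l = b (P2 l) q - b (P1 l) q"
      unfolding Z_def by (rule linear_form_on_diff[OF bq p(4) p(3)])
    ultimately show ?thesis
      using flow[OF u(3) pL(3) pL(4) flow2, of l] flow[OF u(2) pL(2) pL(3) flow1, of l]
      by (simp add: E_def)
  qed
  \<comment> \<open>Row \<open>m\<close> of \<open>A\<close> times its inverse isolates the single
    entry \<open>Y m\<close>.\<close>
  have inv: "(\<Sum>l\<in>UNIV. A $ m $ l * matrix_inv A $ l $ j) = (if m = j then 1 else 0)" for j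
  proof -
    have "A ** matrix_inv A = mat 1"
      using someI_ex[OF A[unfolded invertible_def]] by (simp add: matrix_inv_def)
    then show ?thesis
      by (simp add: matrix_matrix_mult_def vec_eq_iff mat_def)
  qed
  have "0 = (\<Sum>l\<in>UNIV. A $ m $ l * ((\<Sum>j\<in>UNIV. ?I l j * Y j) + Z l))"
    by (simp only: YZ mult_zero_right sum.neutral_const)
  also have "\<dots> = (\<Sum>l\<in>UNIV. \<Sum>j\<in>UNIV. A $ m $ l * matrix_inv A $ l $ j * (Y j / \<tau>)) + (\<Sum>l\<in>UNIV. A $ m $ l * Z l)"
    by (simp add: distrib_left sum.distrib sum_distrib_left mult_ac)
  also have "(\<Sum>l\<in>UNIV. \<Sum>j\<in>UNIV. A $ m $ l * matrix_inv A $ l $ j * (Y j / \<tau>))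
    = (\<Sum>j\<in>UNIV. (\<Sum>l\<in>UNIV. A $ m $ l * matrix_inv A $ l $ j) * (Y j / \<tau>))"
    by (subst sum.swap) (simp only: sum_distrib_right)
  also have "\<dots> = (\<Sum>j\<in>UNIV. if m = j then Y j / \<tau> else 0)"
    by (intro sum.cong) (simp_all add: inv)
  also have "\<dots> = Y m / \<tau>"
    by simp
  finally have "Y m + \<tau> * (\<Sum>l\<in>UNIV. A $ m $ l * Z l) = 0"
    using \<tau> by (simp add: field_simps)
  then show ?thesis by (simp add: Y_def Z_def)
qed

text \<open>In the paper's notation \<open>w = \<A>\<^sup>-\<^sup>1 \<D>\<^sup>* e\<close>, and \<open>a w w = \<langle>\<M> e, e\<rangle>\<close>: the bound locates the
  spectrum of \<open>\<C>\<^sup>-\<^sup>1 \<M>\<close> in \<open>[0, C_d\<^sup>2 / (c_a c_c)]\<close>.\<close>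

lemma coupling_energy_bound:
  assumes a: "elliptic_form V nV a c_a" and c: "elliptic_form H nH c c_c"
    and w: "w \<in> V" and e: "e \<in> H" and eq: "a w w = d w e" and d_bound: "d w e \<le> C_d * nV w * nH e"
  shows "a w w \<le> C_d\<^sup>2 / (c_a * c_c) * c e e"
proof (cases "a w w > 0")
  case True
  note a' = elliptic_formD[OF a] and c' = elliptic_formD[OF c]
  let ?\<omega> = "C_d\<^sup>2 / (c_a * c_c)"
  \<comment> \<open>The bound on \<open>d\<close> is one-sided, so squaring relies on
    \<open>a w w\<close> being positive; afterwards one factor \<open>a w w\<close> is
    cancelled.\<close>
  have "(a w w)\<^sup>2 \<le> (C_d * nV w * nH e)\<^sup>2"
    using True d_bound eq by (intro power_mono) auto
  also have "\<dots> = ?\<omega> * ((c_a * (nV w)\<^sup>2) * (c_c * (nH e)\<^sup>2))"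
    using a'(3) c'(3) by (simp add: power_mult_distrib)
  also have "\<dots> \<le> ?\<omega> * (a w w * c e e)"
    using a'(3) c'(3) a'(5)[OF w]
    by (intro mult_left_mono mult_mono a'(4)[OF w] c'(4)[OF e]) auto
  finally have "a w w * a w w \<le> a w w * (?\<omega> * c e e)"
    by (simp add: power2_eq_square mult_ac)
  then show ?thesis using True by (rule mult_left_le_imp_le)
next
  case False
  have "0 \<le> C_d\<^sup>2 / (c_a * c_c) * c e e"
    using elliptic_formD(3)[OF a] elliptic_formD(3,5)[OF c] e by simp
  with False show ?thesis by linarith
qed

text \<open>Polarization of the symmetric form \<open>L c - \<langle>\<M> \<cdot>, \<cdot>\<rangle>\<close>, with Young's inequality built in.\<close>

lemma coupling_form_bound:
  assumes V: "lin_closed V" and H: "lin_closed H"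
    and a: "elliptic_form V nV a c_a" and c: "elliptic_form H nH c c_c"
    and d: "bilinear_form_on V H d"
    and d_bound: "\<And>u p. u \<in> V \<Longrightarrow> p \<in> H \<Longrightarrow> d u p \<le> C_d * nV u * nH p"
    and w: "w \<in> V" and e: "e \<in> H" and we: "\<And>v. v \<in> V \<Longrightarrow> a w v = d v e"
    and z: "z \<in> V" and q: "q \<in> H" and zq: "\<And>v. v \<in> V \<Longrightarrow> a z v = d v q"
    and \<rho>: "L \<le> \<rho>" "C_d\<^sup>2 / (c_a * c_c) - L \<le> \<rho>"
  shows "2 * \<kappa> * (L * c e q - d w q) \<le> \<rho> * (\<kappa>\<^sup>2 * c e e + c q q)"
proof -
  note a' = elliptic_formD[OF a] and c' = elliptic_formD[OF c]
  \<comment> \<open>The diagonal values of the form at r e + s q, whose potential is r w + s z by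
    linearity.\<close>
  have bound: "\<bar>L * (r\<^sup>2 * c e e + 2 * r * s * c e q + s\<^sup>2 * c q q)
      - (r\<^sup>2 * a w w + 2 * r * s * a w z + s\<^sup>2 * a z z)\<bar>
      \<le> \<rho> * (r\<^sup>2 * c e e + 2 * r * s * c e q + s\<^sup>2 * c q q)" for r s
  proof -
    let ?e = "\<lambda>x. r *\<^sub>R e x + s *\<^sub>R q x" and ?w = "\<lambda>x. r *\<^sub>R w x + s *\<^sub>R z x"
    have e': "?e \<in> H" and w': "?w \<in> V"
      using lin_closedD[OF H e q] lin_closedD[OF V w z] by auto
    have "a ?w ?w = r * a w ?w + s * a z ?w"
      by (rule linear_form_onD[OF bilinear_form_onD(2)[OF a'(1) w'] w z])
    also have "\<dots> = r * d ?w e + s * d ?w q"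
      by (simp add: we[OF w'] zq[OF w'])
    also have "\<dots> = d ?w ?e"
      by (rule linear_form_onD[OF bilinear_form_onD(1)[OF d w'] e q, symmetric])
    finally have energy: "a ?w ?w = d ?w ?e" .
    have "a ?w ?w \<le> C_d\<^sup>2 / (c_a * c_c) * c ?e ?e"
      by (rule coupling_energy_bound[where a = a and c = c and d = d, OF a c w' e' energy d_bound[OF w' e']])
    \<comment> \<open>The two lower bounds on \<rho> serve the two signs: \<omega> - L \<le> \<rho>
      controls energy exceeding the L-term, and L \<le> \<rho> with nonnegative energy controls the
      opposite sign.\<close>
    also have "\<dots> \<le> (\<rho> + L) * c ?e ?e"
      using \<rho> c'(5)[OF e'] by (intro mult_right_mono) auto
    finally have 1: "a ?w ?w \<le> \<rho> * c ?e ?e + L * c ?e ?e"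
      by (simp only: distrib_right)
    have 2: "L * c ?e ?e \<le> \<rho> * c ?e ?e"
      using \<rho>(1) c'(5)[OF e'] by (rule mult_right_mono)
    have "\<bar>L * c ?e ?e - a ?w ?w\<bar> \<le> \<rho> * c ?e ?e"
      using 1 2 a'(5)[OF w'] by linarith
    then show ?thesis
      unfolding bilinear_form_on_square[where h = a, OF a'(1) V w z a'(2)[OF w z]]
        bilinear_form_on_square[where h = c, OF c'(1) H e q c'(2)[OF e q]] .
  qed
  have "d w q = a w z"
    using zq[OF w] a'(2)[OF w z] by simp
  \<comment> \<open>The upper bound at (\<kappa>, 1) minus the lower bound at (\<kappa>, -1) leaves
    four times the mixed term scaled by \<kappa>; on the right the mixed terms of \<open>c\<close>
    cancel by the parallelogram law.\<close>
  then show ?thesis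
    using bound[of \<kappa> 1] bound[of \<kappa> "-1"] by (auto simp: abs_le_iff algebra_simps)
qed

text \<open>Both iterates carry the same load, so the displacement difference is the potential
  belonging to the pressure difference.\<close>

lemma mechanics_equation_difference:
  assumes a: "bilinear_form_on (H10_vec_space \<Omega>) (H10_vec_space \<Omega>) a"
    and d: "bilinear_form_on (H10_vec_space \<Omega>) (L2_space \<Omega>) d"
    and U: "\<And>l. U1 l \<in> H10_vec_space \<Omega>" "\<And>l. U2 l \<in> H10_vec_space \<Omega>"
    and P: "\<And>l. P1 l \<in> H10_space \<Omega>" "\<And>l. P2 l \<in> H10_space \<Omega>"
    and "mechanics_equation \<Omega> a d F U1 P1" "mechanics_equation \<Omega> a d F U2 P2"
    and v: "v \<in> H10_vec_space \<Omega>"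
  shows "a (\<lambda>x. U2 l x - U1 l x) v = d v (\<lambda>x. P2 l x - P1 l x)"
proof -
  have PL: "P1 l \<in> L2_space \<Omega>" "P2 l \<in> L2_space \<Omega>"
    using P H10_space_subset by blast+
  have "a (U1 l) v - d v (P1 l) = F l v" "a (U2 l) v - d v (P2 l) = F l v"
    using assms by (auto simp: mechanics_equation_def)
  then show ?thesis
    by (simp add: linear_form_on_diff[OF bilinear_form_onD(2)[OF a v] U(2) U(1)]
        linear_form_on_diff[OF bilinear_form_onD(1)[OF d v] PL(2) PL(1)])
qed

section \<open>The contraction rate\<close>

text \<open>The distance from \<open>L\<close> is convex in \<mu>, so its maximum over the interval
  is attained at an endpoint.\<close>

lemma rho_FS_eq:
  assumes "\<omega> \<ge> 0" "L > 0"
  shows "rho_FS \<omega> L = max L (\<omega> - L) / (1 + L)"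
  unfolding rho_FS_def
proof (rule Greatest_equality)
  show "max L (\<omega> - L) / (1 + L) \<in> (\<lambda>\<mu>. \<bar>L - \<mu>\<bar> / (1 + L)) ` {0..\<omega>}"
    by (rule image_eqI[where x = "if L \<ge> \<omega> - L then 0 else \<omega>"]) (use assms in auto)
  show "y \<le> max L (\<omega> - L) / (1 + L)" if "y \<in> (\<lambda>\<mu>. \<bar>L - \<mu>\<bar> / (1 + L)) ` {0..\<omega>}" for y
    using that assms by (auto intro!: divide_right_mono)
qed

lemma rho_FS_less_1:
  assumes "\<omega> \<ge> 0" "L > max 0 ((\<omega> - 1) / 2)"
  shows "rho_FS \<omega> L < 1"
  using assms by (simp add: rho_FS_eq)

lemma rho_FS_optimal:
  assumes "\<omega> > 0"
  shows "rho_FS \<omega> (\<omega> / 2) = \<omega> / (2 + \<omega>)"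
  using assms by (simp add: rho_FS_eq field_simps)

text \<open>L / (1 + L) increases and (\<omega> - L) / (1 + L) decreases in \<open>L\<close>; the
  branches of the maximum cross at \<omega> / 2, which is thus the unique minimizer.\<close>

lemma rho_FS_optimal_less:
  assumes "\<omega> > 0" "L > 0" "L \<noteq> \<omega> / 2"
  shows "rho_FS \<omega> (\<omega> / 2) < rho_FS \<omega> L"
proof -
  have "\<omega> / (2 + \<omega>) * (1 + L) < max L (\<omega> - L)"
  proof (cases "L > \<omega> / 2")
    case True
    then have "\<omega> * (1 + L) < L * (2 + \<omega>)" by (simp add: algebra_simps)
    then have "\<omega> / (2 + \<omega>) * (1 + L) < L" using assms by (simp add: field_simps)
    then show ?thesis by simp
  next
    case False
    with assms have "L < \<omega> / 2" by simp
    then have "L * (1 + \<omega>) < \<omega> / 2 * (1 + \<omega>)"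
      using assms by (intro mult_strict_right_mono) auto
    then have "\<omega> * (1 + L) < (\<omega> - L) * (2 + \<omega>)" by (simp add: algebra_simps)
    then have "\<omega> / (2 + \<omega>) * (1 + L) < \<omega> - L" using assms by (simp add: field_simps)
    then show ?thesis by simp
  qed
  moreover have "rho_FS \<omega> L = max L (\<omega> - L) / (1 + L)"
    using assms by (simp add: rho_FS_eq)
  ultimately show ?thesis
    using assms by (simp add: rho_FS_optimal pos_less_divide_eq)
qed

section \<open>Contraction of successive pressure iterates\<close>

theorem theorem4p3:
  fixes \<Omega> :: "(real^'m::finite) set"
    and a :: "(real^'m \<Rightarrow> real^'m) \<Rightarrow> (real^'m \<Rightarrow> real^'m) \<Rightarrow> real"
    and b c :: "(real^'m \<Rightarrow> real) \<Rightarrow> (real^'m \<Rightarrow> real) \<Rightarrow> real"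
    and d :: "(real^'m \<Rightarrow> real^'m) \<Rightarrow> (real^'m \<Rightarrow> real) \<Rightarrow> real"
    and c_a c_b c_c C_d \<omega> \<tau> T L :: real
    and A :: "real^'s^'s::finite" and \<beta> :: "real^'s"
    and f :: "real \<Rightarrow> (real^'m \<Rightarrow> real^'m) \<Rightarrow> real"
    and g :: "real \<Rightarrow> (real^'m \<Rightarrow> real) \<Rightarrow> real"
    and n :: nat
    and u_prev :: "real^'m \<Rightarrow> real^'m" and p_prev :: "real^'m \<Rightarrow> real"
    and F :: "'s \<Rightarrow> (real^'m \<Rightarrow> real^'m) \<Rightarrow> real"
    and G :: "'s \<Rightarrow> (real^'m \<Rightarrow> real) \<Rightarrow> real"
    and U :: "nat \<Rightarrow> 's \<Rightarrow> real^'m \<Rightarrow> real^'m" and P :: "nat \<Rightarrow> 's \<Rightarrow> real^'m \<Rightarrow> real"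
  assumes dim: "CARD('m) \<in> {2, 3}"
    and domain: "bounded_lipschitz_domain \<Omega>"
    and a: "elliptic_form (H10_vec_space \<Omega>) (H1_vec_norm \<Omega>) a c_a"
    and b: "elliptic_form (H10_space \<Omega>) (H1_norm \<Omega>) b c_b"
    and c: "elliptic_form (L2_space \<Omega>) (L2_norm \<Omega>) c c_c"
    and d: "bilinear_form_on (H10_vec_space \<Omega>) (L2_space \<Omega>) d"
    and C_d: "C_d > 0"
    and d_bound: "\<And>u p. u \<in> H10_vec_space \<Omega> \<Longrightarrow> p \<in> L2_space \<Omega> \<Longrightarrow>
                    d u p \<le> C_d * H1_vec_norm \<Omega> u * L2_norm \<Omega> p"
    and omega: "\<omega> = C_d\<^sup>2 / (c_a * c_c)"
    and M_compact: "CinvM_compact \<Omega> a c d"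
    and A_stable: "A_stable A \<beta>"
    and A_inv: "invertible A"
    and R_inf: "\<bar>RK_stability_at_infinity A \<beta>\<bar> < 1"
    and alg_stable: "algebraically_stable A \<beta>"
    and weights: "\<And>l. \<beta> $ l > 0"
    and f: "\<And>t. t \<in> {0..T} \<Longrightarrow> f t \<in> dual_space (H10_vec_space \<Omega>) (H1_vec_norm \<Omega>)"
    and g: "\<And>t. t \<in> {0..T} \<Longrightarrow> g t \<in> dual_space (H10_space \<Omega>) (H1_norm \<Omega>)"
    and tau: "\<tau> > 0"
    and n: "n \<ge> 1"
    and stage_times: "\<And>l. real (n - 1) * \<tau> + RK_nodes A $ l * \<tau> \<in> {0..T}"
    and F: "\<And>l. F l = f (real (n - 1) * \<tau> + RK_nodes A $ l * \<tau>)"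
    and G: "\<And>l. G l = g (real (n - 1) * \<tau> + RK_nodes A $ l * \<tau>)"
    and u_prev: "u_prev \<in> H10_vec_space \<Omega>"
    and p_prev: "p_prev \<in> H10_space \<Omega>"
    and L: "L > 0"
    and iteration: "fixed_stress_iteration \<Omega> a b c d A \<tau> L u_prev p_prev F G U P"
  shows "(\<forall>i\<ge>2. i \<ge> 3 \<or> mechanics_equation \<Omega> a d F (U 0) (P 0) \<longrightarrow>
            stage_norm c \<beta> (\<lambda>l x. P i l x - P (i - 1) l x)
              \<le> rho_FS \<omega> L * stage_norm c \<beta> (\<lambda>l x. P (i - 1) l x - P (i - 2) l x))
       \<and> (\<forall>L'. L' > max 0 ((\<omega> - 1) / 2) \<longrightarrow> rho_FS \<omega> L' < 1)
       \<and> rho_FS \<omega> (\<omega> / 2) = \<omega> / (2 + \<omega>)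
       \<and> (\<forall>L'>0. L' \<noteq> \<omega> / 2 \<longrightarrow> rho_FS \<omega> (\<omega> / 2) < rho_FS \<omega> L')"
proof -
  have \<Omega>: "open \<Omega>" "bounded \<Omega>"
    using domain by (auto simp: bounded_lipschitz_domain_def)
  note V = lin_closed_H10_vec[OF \<Omega>] and Q = lin_closed_H10[OF \<Omega>] and H = lin_closed_L2[of \<Omega>]
  note a' = elliptic_formD[OF a] and b' = elliptic_formD[OF b] and c' = elliptic_formD[OF c]
  have \<omega>: "\<omega> > 0"
    using C_d a'(3) c'(3) by (simp add: omega)
  have U: "U i l \<in> H10_vec_space \<Omega>" and P: "P i l \<in> H10_space \<Omega>" for i l
    using iteration u_prev p_prev by (cases "i = 0"; simp add: fixed_stress_iteration_def)+
  have mech: "mechanics_equation \<Omega> a d F (U i) (P i)"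
    and flow: "flow_equation \<Omega> b c d A \<tau> L u_prev p_prev G (U (i - 1)) (P (i - 1)) (P i)" if "i \<ge> 1" for i
    using iteration that by (auto simp: fixed_stress_iteration_def)
  have contr: "stage_norm c \<beta> (\<lambda>l x. P i l x - P (i - 1) l x)
      \<le> rho_FS \<omega> L * stage_norm c \<beta> (\<lambda>l x. P (i - 1) l x - P (i - 2) l x)"
    if i: "i \<ge> 2" and start: "i \<ge> 3 \<or> mechanics_equation \<Omega> a d F (U 0) (P 0)" for i
  proof -
    define q e where "q = (\<lambda>l x. P i l x - P (i - 1) l x)" and "e = (\<lambda>l x. P (i - 1) l x - P (i - 2) l x)"
    define z w where "z = (\<lambda>l x. U i l x - U (i - 1) l x)" and "w = (\<lambda>l x. U (i - 1) l x - U (i - 2) l x)"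
    have qQ: "q l \<in> H10_space \<Omega>" and eQ: "e l \<in> H10_space \<Omega>"
      and zV: "z l \<in> H10_vec_space \<Omega>" and wV: "w l \<in> H10_vec_space \<Omega>" for l
      unfolding q_def e_def z_def w_def using lin_closed_diff[OF Q P P] lin_closed_diff[OF V U U] by auto
    have qH: "q l \<in> L2_space \<Omega>" and eH: "e l \<in> L2_space \<Omega>" for l
      using qQ eQ H10_space_subset by blast+
    \<comment> \<open>For i = 2 the older iterate is the initial guess, on which the iteration
      imposes no mechanics equation; there it comes from \<open>start\<close>. From i = 3 on it
      comes from the iteration.\<close>
    have mech': "mechanics_equation \<Omega> a d F (U (i - 2)) (P (i - 2))"
      using start mech[of "i - 2"] i by (cases "i = 2") auto
    have zq: "a (z l) v = d v (q l)" and we: "a (w l) v = d v (e l)" if "v \<in> H10_vec_space \<Omega>" for l v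
      unfolding q_def e_def z_def w_def using that i mech' mech[of i] mech[of "i - 1"]
      by (auto intro!: mechanics_equation_difference[OF a'(1) d U U P P])
    have step: "(1 + L) * c (q m) q' + \<tau> * (\<Sum>l\<in>UNIV. A $ m $ l * b (q l) q') = L * c (e m) q' - d (w m) q'"
      if "q' \<in> H10_space \<Omega>" for m q'
      unfolding q_def e_def w_def
      using flow[of i] flow[of "i - 1"] i that
      by (intro flow_equation_difference[OF \<Omega> b'(1) c'(1) d A_inv tau u_prev U U p_prev P P P, where G = G])
        (auto simp: numeral_2_eq_2)
    define X Y where "X = (\<Sum>l\<in>UNIV. \<beta> $ l * c (e l) (e l))" and "Y = (\<Sum>l\<in>UNIV. \<beta> $ l * c (q l) (q l))"
    define W where "W = (\<Sum>l\<in>UNIV. \<beta> $ l * (L * c (e l) (q l) - d (w l) (q l)))"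
    have XY: "stage_norm c \<beta> e = sqrt X" "stage_norm c \<beta> q = sqrt Y"
      using c'(5)[OF eH] c'(5)[OF qH] by (simp_all add: stage_norm_def form_norm_def X_def Y_def)
    \<comment> \<open>\<kappa> is both the contraction rate and the weight in Young's inequality.
      With \<rho> = \<kappa> (1 + L), the factor \<kappa> (1 + L) occurs on both sides of the final
      estimate and cancels.\<close>
    define \<rho> \<kappa> where "\<rho> = max L (\<omega> - L)" and "\<kappa> = \<rho> / (1 + L)"
    have \<kappa>: "\<kappa> > 0" "\<rho> = \<kappa> * (1 + L)" "rho_FS \<omega> L = \<kappa>"
      using L \<omega> by (auto simp: \<rho>_def \<kappa>_def rho_FS_eq)
    \<comment> \<open>Equation \<open>l\<close> is tested with \<open>q l\<close> and summed with
      weight \<beta> at \<open>l\<close>; the elliptic terms become the Runge-Kutta form of the Gram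
      matrix of \<open>b\<close>.\<close>
    have "W = (1 + L) * Y + \<tau> * (\<Sum>l\<in>UNIV. \<Sum>j\<in>UNIV. \<beta> $ l * A $ l $ j * b (q l) (q j))"
      unfolding W_def Y_def step[OF qQ, symmetric] b'(2)[OF qQ qQ]
      by (simp add: distrib_left sum.distrib sum_distrib_left b'(2)[OF qQ qQ] mult_ac)
    moreover have "0 \<le> (\<Sum>l\<in>UNIV. \<Sum>j\<in>UNIV. \<beta> $ l * A $ l $ j * b (q l) (q j))"
    proof (rule algebraically_stable_gram_nonneg[where B = "\<lambda>l j. b (q l) (q j)", OF alg_stable b'(2)[OF qQ qQ]])
      fix x :: "'s \<Rightarrow> real"
      have "(\<lambda>y. \<Sum>l\<in>UNIV. x l *\<^sub>R q l y) \<in> H10_space \<Omega>"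
        by (rule lin_closed_sum[OF Q]) (use qQ in auto)
      from b'(5)[OF this] show "0 \<le> (\<Sum>l\<in>UNIV. \<Sum>j\<in>UNIV. x l * x j * b (q l) (q j))"
        by (simp only: bilinear_form_on_gram[OF b'(1) Q qQ])
    qed
    ultimately have "(1 + L) * Y \<le> W"
      using tau by simp
    then have "2 * \<kappa> * ((1 + L) * Y) \<le> 2 * \<kappa> * W"
      using \<kappa> by (intro mult_left_mono) auto
    also have "\<dots> = (\<Sum>l\<in>UNIV. \<beta> $ l * (2 * \<kappa> * (L * c (e l) (q l) - d (w l) (q l))))"
      by (simp add: W_def sum_distrib_left mult_ac)
    \<comment> \<open>The coupling bound applies stage by stage, with \<open>w l\<close> and
      \<open>z l\<close> as the potentials of \<open>e l\<close> and \<open>q l\<close>; positive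
      weights preserve it in the sum.\<close>
    also have "\<dots> \<le> (\<Sum>l\<in>UNIV. \<beta> $ l * (\<rho> * (\<kappa>\<^sup>2 * c (e l) (e l) + c (q l) (q l))))"
    proof (intro sum_mono mult_left_mono)
      show "2 * \<kappa> * (L * c (e l) (q l) - d (w l) (q l)) \<le> \<rho> * (\<kappa>\<^sup>2 * c (e l) (e l) + c (q l) (q l))" for l
        by (rule coupling_form_bound[where a = a and c = c and d = d, OF V H a c d _ wV eH _ zV qH])
          (auto simp: \<rho>_def omega we zq intro: d_bound)
    qed (use weights less_imp_le in auto)
    also have "\<dots> = \<kappa> * (1 + L) * (\<kappa>\<^sup>2 * X + Y)"
      by (simp add: X_def Y_def \<kappa>(2) distrib_left sum.distrib sum_distrib_left mult_ac)
    finally have "(\<kappa> * (1 + L)) * (2 * Y) \<le> (\<kappa> * (1 + L)) * (\<kappa>\<^sup>2 * X + Y)"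
      by (simp add: mult_ac)
    \<comment> \<open>One of the two copies of \<open>Y\<close> is absorbed on the left, which
      leaves \<open>Y\<close> bounded by \<open>\<kappa>\<^sup>2 * X\<close>.\<close>
    then have "2 * Y \<le> \<kappa>\<^sup>2 * X + Y"
      using \<kappa> L by (subst (asm) mult_le_cancel_left_pos) auto
    then have "sqrt Y \<le> sqrt (\<kappa>\<^sup>2 * X)" by simp
    also have "\<dots> = \<kappa> * sqrt X" using \<kappa> by (simp add: real_sqrt_mult)
    finally have "stage_norm c \<beta> q \<le> rho_FS \<omega> L * stage_norm c \<beta> e"
      by (simp only: XY \<kappa>(3))
    then show ?thesis by (simp only: q_def e_def)
  qed
  show ?thesis
    using contr \<omega> rho_FS_less_1[of \<omega>] rho_FS_optimal[OF \<omega>] rho_FS_optimal_less[OF \<omega>] by (auto simp del: max_less_iff_conj)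
qed

end
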